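(* Let $T$ be an expanding polynomial of degree $d\ge2$ with real Julia set, and for $n\ge 1$ and $x\in[-\xi,\xi]$ let $(FD)_n=(FD)_n(x)$ be the $d^n\times d^n$ matrix $FD$ constructed (as described in the context) from the iterate $T_n=T^{\circ n}$. Let $L_2$ be the Ruelle operator $L_2g(x)=\frac1d\sum_{T(y)=x}\frac{g(y)}{T'(y)^2}$ and let $S(T)=\frac{T'''}{T'}-\frac32\left(\frac{T''}{T'}\right)^2$ be the Schwarz derivative of $T$. Then, for $x\in[-\xi,\xi]$, the limit below exists and $$\lim_{n\to\infty}\frac1{d^n}\operatorname{tr}\{(FD)_n^*(FD)_n\}=-\frac13\,\big((I-L_2)^{-1}L_2\,S(T)\big)(x).$$
   Context: A polynomial $T$ of degree $d\ge2$ with Julia set $E$ is expanding if there are $A>0$, $c>1$ with $|T_n'(x)|\ge A c^n$ for all $x\in E$, $n\ge1$, where $T_n=T^{\circ n}$. It is assumed that $E\subset\mathbb R$, that $[-\xi,\xi]$ is the smallest interval containing $E$, and that $T^{-1}([-\xi,\xi])\subset[-\xi,\xi]$ (full preimage in $\mathbb C$). For each $x\in[-\xi,\xi]$ the $d$ roots $\lambda_1(x)<\dots<\lambda_d(x)$ of $T(\lambda)=x$ are real and distinct. The iterates $T_n$ satisfy the same assumptions with $d$ replaced by $d^n$ and the same $\xi$. Construction of $FD$ from $T$ and $x$: $J=J(x)$ is the $d\times d$ Jacobi matrix (symmetric tridiagonal, positive off-diagonal entries) with $\langle 0|(z-J)^{-1}|0\rangle=\frac{T'(z)/d}{T(z)-x}$,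 where $|0\rangle,\dots,|d-1\rangle$ is the standard basis of $\mathbb C^d$; equivalently $J$ is the Jacobi matrix of the measure $\frac1d\sum_{k}\delta_{\lambda_k(x)}$. Let $P_0,\dots,P_{d-1}$ be the orthonormal polynomials of this measure, so that $P_k(J)|0\rangle=|k\rangle$. Then $F=T'(J)^{-1}$ and $D$ is the linear operator with $D|k\rangle=P_k'(J)|0\rangle$ for $0\le k\le d-1$. The matrix $(FD)_n$ is obtained by the same construction with $T_n$, $d^n$ in place of $T$, $d$ (and the same $x$). $L_2$ is regarded as an operator on continuous functions on $[-\xi,\xi]$; for $x\in[-\xi,\xi]$, $L_2g(x)$ involves only the values of $g$ on $T^{-1}([-\xi,\xi])\subset[-\xi,\xi]$, on which $T'\ne0$, so that $L_2S(T)$ is a continuous function on $[-\xi,\xi]$. *)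

theory Defs
  imports
    "HOL-Analysis.Convex_Euclidean_Space"
    "HOL-Computational_Algebra.Polynomial"
    "HOL-Library.FuncSet"
    "Jordan_Normal_Form.Gauss_Jordan_Elimination"
    "Jordan_Normal_Form.Schur_Decomposition"
begin

section \<open>Expanding polynomials\<close>

definition poly_iterate :: "complex poly \<Rightarrow> nat \<Rightarrow> complex poly" where
  "poly_iterate T n = (pcompose T ^^ n) [:0, 1:]"

definition filled_julia :: "complex poly \<Rightarrow> complex set" where
  "filled_julia T = {z. bounded (range (\<lambda>n. poly (poly_iterate T n) z))}"

definition julia :: "complex poly \<Rightarrow> complex set" where
  "julia T = frontier (filled_julia T)"

definition expanding :: "complex poly \<Rightarrow> bool" where
  "expanding T \<longleftrightarrow> (\<exists>A c::real. A > 0 \<and> c > 1 \<and>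
     (\<forall>z \<in> julia T. \<forall>n \<ge> 1. norm (poly (pderiv (poly_iterate T n)) z) \<ge> A * c ^ n))"

text \<open>The real interval from \<open>-\<xi>\<close> to \<open>\<xi>\<close>, as a subset of the complex plane.\<close>

definition sym_interval :: "real \<Rightarrow> complex set" where
  "sym_interval \<xi> = complex_of_real ` {-\<xi>..\<xi>}"


section \<open>The Jacobi matrix and the matrix \<open>FD\<close>\<close>

definition jacobi_matrix :: "nat \<Rightarrow> complex mat \<Rightarrow> bool" where
  "jacobi_matrix d J \<longleftrightarrow> J \<in> carrier_mat d d \<and>
     (\<forall>i<d. \<forall>j<d. J $$ (i, j) \<in> \<real> \<and> J $$ (i, j) = J $$ (j, i)) \<and>
     (\<forall>i<d. \<forall>j<d. i + 1 < j \<longrightarrow> J $$ (i, j) = 0) \<and>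
     (\<forall>i. i + 1 < d \<longrightarrow> Re (J $$ (i, i + 1)) > 0)"

text \<open>The resolvent identity is an identity of rational functions of \<open>z\<close>, so it is required
  wherever both sides are defined. When the roots of \<open>T(y) = x\<close> are real and simple it
  determines \<open>J\<close> uniquely.\<close>

definition jacobi_of :: "complex poly \<Rightarrow> complex \<Rightarrow> complex mat" where
  "jacobi_of T x = (let d = degree T in THE J. jacobi_matrix d J \<and>
     (\<forall>z. invertible_mat (z \<cdot>\<^sub>m 1\<^sub>m d - J) \<and> poly T z \<noteq> x \<longrightarrow>
        the (mat_inverse (z \<cdot>\<^sub>m 1\<^sub>m d - J)) $$ (0, 0) =
          (poly (pderiv T) z / of_nat d) / (poly T z - x)))"

text \<open>The \<open>L\<^sup>2\<close> inner product of two polynomials for the measure giving mass \<open>1/d\<close> to each root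
  of \<open>T(y) = x\<close> (the roots are simple wherever this is used).\<close>

definition root_inner :: "complex poly \<Rightarrow> complex \<Rightarrow> complex poly \<Rightarrow> complex poly \<Rightarrow> complex" where
  "root_inner T x p q =
     (1 / of_nat (degree T)) * (\<Sum>y | poly T y = x. poly p y * cnj (poly q y))"

text \<open>Only the values at \<open>k < degree T\<close> are meaningful, and they are uniquely determined by the
  stated conditions.\<close>

definition orthonormal_polys :: "complex poly \<Rightarrow> complex \<Rightarrow> nat \<Rightarrow> complex poly" where
  "orthonormal_polys T x = (SOME P. \<forall>k < degree T.
     degree (P k) = k \<and> lead_coeff (P k) \<in> \<real> \<and> Re (lead_coeff (P k)) > 0 \<and>
     (\<forall>j < degree T. root_inner T x (P j) (P k) = (if j = k then 1 else 0)))"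

definition poly_mat :: "complex poly \<Rightarrow> complex mat \<Rightarrow> complex mat" where
  "poly_mat p A = mat (dim_row A) (dim_row A)
     (\<lambda>(i, j). \<Sum>k \<le> degree p. coeff p k * (A ^\<^sub>m k) $$ (i, j))"

definition F_mat :: "complex poly \<Rightarrow> complex \<Rightarrow> complex mat" where
  "F_mat T x = the (mat_inverse (poly_mat (pderiv T) (jacobi_of T x)))"

definition D_mat :: "complex poly \<Rightarrow> complex \<Rightarrow> complex mat" where
  "D_mat T x = (let d = degree T in mat_of_cols d
     (map (\<lambda>k. poly_mat (pderiv (orthonormal_polys T x k)) (jacobi_of T x) *\<^sub>v unit_vec d 0) [0..<d]))"

definition FD_mat :: "complex poly \<Rightarrow> complex \<Rightarrow> complex mat" where
  "FD_mat T x = F_mat T x * D_mat T x"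

definition mat_trace :: "complex mat \<Rightarrow> complex" where
  "mat_trace A = (\<Sum>i < dim_row A. A $$ (i, i))"


section \<open>The Ruelle operator\<close>

text \<open>Continuous functions on a set are represented by their extensional representatives
  (undefined outside the set), so that equality is equality on the set.\<close>

definition continuous_functions :: "complex set \<Rightarrow> (complex \<Rightarrow> complex) set" where
  "continuous_functions I = {g \<in> extensional I. continuous_on I g}"

definition ruelle2 :: "complex poly \<Rightarrow> complex set \<Rightarrow> (complex \<Rightarrow> complex) \<Rightarrow> complex \<Rightarrow> complex" where
  "ruelle2 T I g = (\<lambda>x\<in>I. (1 / of_nat (degree T)) *
     (\<Sum>y | poly T y = x. g y / (poly (pderiv T) y)\<^sup>2))"

definition id_minus_ruelle2 ::
    "complex poly \<Rightarrow> complex set \<Rightarrow> (complex \<Rightarrow> complex) \<Rightarrow> complex \<Rightarrow> complex" where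
  "id_minus_ruelle2 T I g = (\<lambda>x\<in>I. g x - ruelle2 T I g x)"

definition schwarzian :: "complex poly \<Rightarrow> complex \<Rightarrow> complex" where
  "schwarzian T z =
     poly (pderiv (pderiv (pderiv T))) z / poly (pderiv T) z
     - 3 / 2 * (poly (pderiv (pderiv T)) z / poly (pderiv T) z)\<^sup>2"

end

theory Submission
  imports
    Defs
    "HOL-Computational_Algebra.Fundamental_Theorem_Algebra"
    "HOL-Analysis.Uniform_Limit"
begin

text \<open>
  For each single iterate the normalised trace is already an exact value of the Ruelle operator; the
  limit only concerns powers of that operator.

  \<^emph>\<open>One polynomial.\<close> Let \<open>S\<close> have degree \<open>d\<close> and real simple roots over \<open>x\<close>. The map
  \<open>f \<mapsto> f(J)|0\<rangle>\<close> is an isometry from the functions on the fibre \<open>S(y) = x\<close>, with mass \<open>1/d\<close> on each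
  root, onto \<open>\<complex>\<^sup>d\<close>; the orthonormal polynomial \<open>P\<^sub>k\<close> goes to \<open>|k\<rangle>\<close>. In this picture \<open>J\<close> is
  multiplication by \<open>y\<close>, \<open>F\<close> is multiplication by \<open>1/S'\<close>, and \<open>D\<close> differentiates the interpolation
  polynomial of degree below \<open>d\<close>. So \<open>FD\<close> is \<open>f \<mapsto> f'/S'\<close>, and in the basis of Lagrange polynomials its
  matrix entries are \<open>1 / ((a - b) S'(b))\<close> off the diagonal and \<open>S''(b) / (2 S'(b)\<^sup>2)\<close> on it. The sum of
  \<open>1/(a - b)\<^sup>2\<close> over the other roots \<open>a\<close> is minus the derivative of a logarithmic derivative, hence a rational
  expression in \<open>S', S'', S'''\<close> at \<open>b\<close>, and the squares of column \<open>b\<close> add up to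
  \<open>-1/3 schwarzian S b / S'(b)\<^sup>2\<close> (\<open>sum_lagrange_deriv\<close>). Thus the trace divided by
  \<open>d\<close> is \<open>-1/3\<close> times the Ruelle operator of \<open>S\<close> applied to its Schwarzian (\<open>trace_FD\<close>). Since \<open>J\<close> is
  specified by its resolvent only, one also has to recover it from the resolvent: the expansion at
  infinity gives the moments, and the moments give the orthonormal polynomials (\<open>jacobi_of_eq\<close>).

  \<^emph>\<open>Iterates.\<close> Let \<open>a\<^sub>n\<close> be the Ruelle operator of \<open>T\<^sub>n\<close> applied to the Schwarzian of \<open>T\<^sub>n\<close>. The cocycle
  identity of the Schwarzian gives \<open>a\<^sub>n\<^sub>+\<^sub>1 = L\<^sub>2 (schwarzian T) + L\<^sub>2 a\<^sub>n\<close> with \<open>a\<^sub>0 = 0\<close>. If \<open>h\<close> solves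
  \<open>(I - L\<^sub>2) h = L\<^sub>2 (schwarzian T)\<close>, then \<open>h - a\<^sub>n = L\<^sub>2\<^sup>n h\<close>, so everything rests on \<open>L\<^sub>2\<^sup>n \<rightarrow> 0\<close> exponentially; this
  also yields the inverse of \<open>I - L\<^sub>2\<close> as a Neumann series.

  \<^emph>\<open>Exponential decay.\<close> \<open>L\<^sub>2\<^sup>n g (x)\<close> is the average of \<open>g(y) / T\<^sub>n'(y)\<^sup>2\<close> over \<open>T\<^sub>n(y) = x\<close>, so it
  suffices that \<open>|T\<^sub>n'|\<close> grows exponentially on \<open>T\<^sub>n\<^sup>-\<^sup>1(I)\<close>, uniformly, where \<open>I\<close> is the interval
  (\<open>iterate_deriv_decay\<close>). Expansion is assumed on the Julia set only. The sets \<open>T\<^sub>n\<^sup>-\<^sup>1(I)\<close> are compact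
  and decrease to the filled Julia set, which here coincides with the Julia set, because a bounded set
  with real frontier has empty interior. It remains to exclude critical points in these sets
  (\<open>deriv_nonzero\<close>): for a value inside \<open>I\<close> this follows from Laguerre's inequality for polynomials with
  real roots, applied to \<open>T - \<xi>\<close> and \<open>T + \<xi>\<close>; for an endpoint it follows from expansion.
\<close>

section \<open>Iterates of a polynomial\<close>

lemma poly_iterate_0 [simp]: "poly_iterate T 0 = [:0, 1:]"
  by (simp add: poly_iterate_def)

lemma poly_iterate_Suc: "poly_iterate T (Suc n) = pcompose T (poly_iterate T n)"
  by (simp add: poly_iterate_def)

lemma poly_poly_iterate: "poly (poly_iterate T n) z = (poly T ^^ n) z"
  by (induction n) (simp_all add: poly_iterate_Suc poly_pcompose)

lemma degree_poly_iterate: "degree (poly_iterate T n) = degree T ^ n"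
  by (induction n) (simp_all add: poly_iterate_Suc)

lemma poly_iterate_add:
  "poly_iterate T (m + n) = pcompose (poly_iterate T m) (poly_iterate T n)"
  by (induction m) (simp_all add: poly_iterate_Suc pcompose_assoc pcompose_idR pcompose_pCons)


lemma degree_diff_eq_left:
  fixes p q :: "'a::ab_group_add poly"
  shows "degree q < degree p \<Longrightarrow> degree (p - q) = degree p"
  by (metis degree_add_eq_left degree_minus diff_conv_add_uminus)


section \<open>The filled Julia set\<close>

lemma poly_escape_radius:
  fixes T :: "complex poly"
  assumes "degree T \<ge> 2"
  obtains R where "R > 0" "\<And>z. norm z > R \<Longrightarrow> norm (poly T z) \<ge> 2 * norm z"
proof -
  obtain a q where T: "T = pCons a q" by (cases T) auto
  have "degree q > 0" using assms unfolding T by (auto split: if_splits)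
  then obtain b r where q: "q = pCons b r" "r \<noteq> 0"
    by (cases q) (auto split: if_splits)
  obtain R where R: "\<And>z. R \<le> norm z \<Longrightarrow> 3 \<le> norm (poly q z)"
    using poly_infinity[OF q(2), of 3 b] q(1) by auto
  show ?thesis
  proof (rule that[of "max (max R (norm a)) 1"])
    fix z :: complex assume z: "norm z > max (max R (norm a)) 1"
    have "3 * norm z \<le> norm (poly q z) * norm z"
      using R[of z] z by (intro mult_right_mono) auto
    moreover have "norm (poly T z) \<ge> norm (z * poly q z) - norm a"
      unfolding T using norm_diff_ineq[of "z * poly q z" a] by (simp add: add.commute)
    ultimately show "norm (poly T z) \<ge> 2 * norm z"
      using z by (simp add: norm_mult mult.commute)
  qed auto
qed

text \<open>Outside the disc of radius \<open>R\<close> the modulus at least doubles in every step, so an orbit that leaves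
  the disc once is unbounded.\<close>

lemma filled_julia_eq_orbits_in_disc:
  assumes R: "R > 0" "\<And>z. norm z > R \<Longrightarrow> norm (poly T z) \<ge> 2 * norm z"
  shows "filled_julia T = {z. \<forall>n. norm (poly (poly_iterate T n) z) \<le> R}"
proof (intro equalityI subsetI CollectI allI)
  fix z n assume z: "z \<in> filled_julia T"
  then obtain B where B: "\<And>n. norm ((poly T ^^ n) z) \<le> B"
    by (auto simp: filled_julia_def bounded_iff poly_poly_iterate)
  show "norm (poly (poly_iterate T n) z) \<le> R"
  proof (rule ccontr)
    define w where "w = (poly T ^^ n) z"
    assume "\<not> norm (poly (poly_iterate T n) z) \<le> R"
    then have w: "norm w > R" by (simp add: w_def poly_poly_iterate)
    have *: "norm ((poly T ^^ k) w) \<ge> 2 ^ k * norm w" for k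
    proof (induction k)
      case (Suc k)
      have "1 * norm w \<le> 2 ^ k * norm w" by (intro mult_right_mono) auto
      then have "norm ((poly T ^^ k) w) > R" using Suc w by linarith
      from R(2)[OF this] show ?case using Suc by simp
    qed simp
    obtain k where "B / R < 2 ^ k" using real_arch_pow[of 2 "B / R"] by auto
    then have "B < 2 ^ k * R" using R(1) by (simp add: field_simps)
    also have "\<dots> \<le> 2 ^ k * norm w" using w by simp
    also have "\<dots> \<le> norm ((poly T ^^ (k + n)) z)" using *[of k] by (simp add: w_def funpow_add)
    finally show False using B[of "k + n"] by simp
  qed
next
  fix z assume "z \<in> {z. \<forall>n. norm (poly (poly_iterate T n) z) \<le> R}"
  then show "z \<in> filled_julia T" by (auto simp: filled_julia_def bounded_iff)
qed

lemma closed_filled_julia: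
  assumes "degree T \<ge> 2" shows "closed (filled_julia T)"
proof -
  obtain R where "R > 0" "\<And>z. norm z > R \<Longrightarrow> norm (poly T z) \<ge> 2 * norm z"
    using poly_escape_radius[OF assms] by blast
  from filled_julia_eq_orbits_in_disc[OF this]
  have "filled_julia T = (\<Inter>n. {z. norm (poly (poly_iterate T n) z) \<le> R})" by auto
  moreover have "closed {z. norm (poly (poly_iterate T n) z) \<le> R}" for n
    by (intro closed_Collect_le continuous_intros)
  ultimately show ?thesis by auto
qed

lemma bounded_filled_julia:
  assumes "degree T \<ge> 2" shows "bounded (filled_julia T)"
proof -
  obtain R where "R > 0" "\<And>z. norm z > R \<Longrightarrow> norm (poly T z) \<ge> 2 * norm z"
    using poly_escape_radius[OF assms] by blast
  from filled_julia_eq_orbits_in_disc[OF this]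
  have "filled_julia T \<subseteq> cball 0 R" by (auto dest: spec[of _ 0])
  then show ?thesis using bounded_subset bounded_cball by blast
qed

lemma filled_julia_vimage: "poly T z \<in> filled_julia T \<Longrightarrow> z \<in> filled_julia T"
proof -
  assume "poly T z \<in> filled_julia T"
  then obtain B where B: "\<And>n. norm ((poly T ^^ n) (poly T z)) \<le> B"
    by (auto simp: filled_julia_def bounded_iff poly_poly_iterate)
  have "norm ((poly T ^^ n) z) \<le> max B (norm z)" for n
  proof (cases n)
    case (Suc m)
    then show ?thesis using B[of m] by (simp only: funpow_Suc_right o_apply max.coboundedI1)
  qed auto
  then show ?thesis by (auto simp: filled_julia_def bounded_iff poly_poly_iterate)
qed

text \<open>Fixed points have bounded orbits, and \<open>T(z) = z\<close> is solvable because \<open>T(z) - z\<close> is not constant.\<close>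

lemma filled_julia_nonempty:
  assumes "degree T \<ge> 2" shows "filled_julia T \<noteq> {}"
proof -
  have "degree (T - [:0, 1:]) = degree T"
    using assms by (simp add: degree_diff_eq_left)
  then have "\<not> constant (poly (T - [:0, 1:]))" using assms by (simp add: constant_degree)
  then obtain z where "poly T z = z"
    using fundamental_theorem_of_algebra by fastforce
  then have "(poly T ^^ n) z = z" for n by (induction n) simp_all
  then have "z \<in> filled_julia T" by (simp add: filled_julia_def poly_poly_iterate)
  then show ?thesis by blast
qed

text \<open>A bounded set with real frontier cannot meet the open half planes: each half plane is
  connected and unbounded. So the set is contained in the real line and has no interior.\<close>

lemma bounded_frontier_real:
  fixes K :: "complex set"
  assumes K: "bounded K" and fr: "frontier K \<subseteq> \<real>"
  shows "K \<subseteq> frontier K"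
proof -
  have half: "z \<notin> K" if "s \<noteq> 0" "s * Im z > 0" for s z
  proof
    assume z: "z \<in> K"
    let ?H = "{w. s * Im w > 0}"
    have eq: "?H = {w. inner (Complex 0 s) w > 0}" by (auto simp: inner_complex_def)
    have "connected ?H" unfolding eq by (intro convex_connected convex_halfspace_gt)
    obtain B where B: "\<And>w. w \<in> K \<Longrightarrow> norm w \<le> B" using K by (auto simp: bounded_iff)
    define w where "w = Complex 0 ((\<bar>B\<bar> + 1) * sgn s)"
    have "s * Im w = (\<bar>B\<bar> + 1) * \<bar>s\<bar>" by (simp add: w_def abs_sgn[of s])
    then have wH: "w \<in> ?H" using that(1) by (simp add: add_pos_nonneg)
    have "norm w = \<bar>B\<bar> + 1" using that(1) by (simp add: w_def cmod_def abs_mult sgn_if)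
    then have "w \<notin> K" using B[of w] by auto
    have "?H \<inter> frontier K \<noteq> {}"
      by (rule connected_Int_frontier) (use \<open>connected ?H\<close> z that(2) \<open>w \<notin> K\<close> wH in auto)
    moreover have "Im v = 0" if "v \<in> frontier K" for v
      using fr that by (auto simp: complex_is_Real_iff)
    ultimately show False by auto
  qed
  have Kreal: "Im z = 0" if "z \<in> K" for z
    using half[of 1 z] half[of "-1" z] that by (cases "Im z" "0::real" rule: linorder_cases) auto
  have "z \<notin> interior K" if "z \<in> K" for z
  proof
    assume "z \<in> interior K"
    then obtain e where e: "e > 0" "ball z e \<subseteq> K" by (auto simp: mem_interior)
    have "z + Complex 0 (e/2) \<in> ball z e" using e(1) by (simp add: dist_norm cmod_def)
    then have "Im (z + Complex 0 (e/2)) = 0" using Kreal e(2) by blast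
    then show False using Kreal[OF that] e(1) by simp
  qed
  then show ?thesis using closure_subset by (auto simp: frontier_def)
qed

lemma filled_julia_eq_julia:
  assumes "degree T \<ge> 2" "julia T \<subseteq> \<real>"
  shows "filled_julia T = julia T"
proof
  show "filled_julia T \<subseteq> julia T"
    using bounded_frontier_real[OF bounded_filled_julia[OF assms(1)]] assms(2)
    by (simp add: julia_def)
  show "julia T \<subseteq> filled_julia T"
    using frontier_subset_closed[OF closed_filled_julia[OF assms(1)]] by (simp add: julia_def)
qed


section \<open>Polynomials with real roots\<close>

text \<open>These are \<open>P'/P = \<Sum>1/(c - a)\<close> and \<open>-(P'/P)' = \<Sum>1/(c - a)\<^sup>2\<close>, cleared of denominators. The first gives
  the resolvent entry of the Jacobi matrix; the second gives Laguerre's inequality and the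
  off-diagonal part of the trace.\<close>

lemma pderiv_prod_linear:
  fixes A :: "complex multiset" and c :: complex
  defines "P \<equiv> \<lambda>A. (\<Prod>a\<in>#A. [:-a, 1:])"
  assumes "c \<notin># A"
  shows "poly (pderiv (P A)) c = poly (P A) c * (\<Sum>a\<in>#A. 1 / (c - a))"
    and "(poly (pderiv (P A)) c)\<^sup>2 - poly (P A) c * poly (pderiv (pderiv (P A))) c
      = (poly (P A) c)\<^sup>2 * (\<Sum>a\<in>#A. 1 / (c - a)\<^sup>2)"
  using assms(2)
proof (induction A)
  case (add a A)
  define p where "p = poly (P A) c"
  define p1 where "p1 = poly (pderiv (P A)) c"
  define p2 where "p2 = poly (pderiv (pderiv (P A))) c"
  have PA: "P (add_mset a A) = [:-a, 1:] * P A" by (simp add: P_def)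
  have derivs: "poly (P (add_mset a A)) c = (c - a) * p"
    "poly (pderiv (P (add_mset a A))) c = (c - a) * p1 + p"
    "poly (pderiv (pderiv (P (add_mset a A)))) c = (c - a) * p2 + 2 * p1"
    unfolding PA p_def p1_def p2_def pderiv_mult pderiv_add
    by (simp_all add: pderiv_pCons algebra_simps)
  {
    case 1
    define s where "s = (\<Sum>a\<in>#A. 1 / (c - a))"
    have "p1 = p * s" using add(1) 1 by (simp add: p_def p1_def s_def)
    then have "(c - a) * p1 + p = ((c - a) * p) * (1 / (c - a) + s)"
      using 1 by (auto simp: field_simps)
    then show ?case unfolding derivs by (simp add: s_def)
  next
    case 2
    define \<sigma> where "\<sigma> = (\<Sum>a\<in>#A. 1 / (c - a)\<^sup>2)"
    have IH: "p1\<^sup>2 - p * p2 = p\<^sup>2 * \<sigma>"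
      using add(2) 2 by (simp add: p_def p1_def p2_def \<sigma>_def)
    have "((c - a) * p1 + p)\<^sup>2 - ((c - a) * p) * ((c - a) * p2 + 2 * p1)
        = (c - a)\<^sup>2 * (p1\<^sup>2 - p * p2) + p\<^sup>2"
      by (simp add: power2_eq_square algebra_simps)
    also have "\<dots> = ((c - a) * p)\<^sup>2 * (1 / (c - a)\<^sup>2 + \<sigma>)"
      unfolding IH using 2 by (simp add: power_mult_distrib distrib_left mult_ac)
    finally show ?case unfolding derivs by (simp add: \<sigma>_def)
  }
qed (auto simp: P_def)

lemma prod_linear_real_roots:
  fixes A :: "complex multiset" and c :: complex
  assumes "\<And>a. a \<in># A \<Longrightarrow> a \<in> \<real>" and "c \<in> \<real>" and "c \<notin># A"
  shows "poly (\<Prod>a\<in>#A. [:-a, 1:]) c \<in> \<real> - {0}"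
    and "\<exists>r\<ge>0. (A \<noteq> {#} \<longrightarrow> r > 0) \<and> (\<Sum>a\<in>#A. 1 / (c - a)\<^sup>2) = complex_of_real r"
  using assms(1,3)
proof (induction A)
  case (add a A)
  {
    case 1
    have "c - a \<in> \<real> - {0}" using 1 assms(2) by auto
    moreover have "poly (\<Prod>a\<in>#A. [:-a, 1:]) c \<in> \<real> - {0}" using add(1) 1 by auto
    moreover have "poly (\<Prod>a\<in>#add_mset a A. [:-a, 1:]) c = (c - a) * poly (\<Prod>a\<in>#A. [:-a, 1:]) c"
      by (simp add: algebra_simps)
    ultimately show ?case by auto
  next
    case 2
    obtain r where r: "r \<ge> 0" "(\<Sum>a\<in>#A. 1 / (c - a)\<^sup>2) = complex_of_real r"
      using add(2) 2 by auto
    obtain u where u: "c - a = complex_of_real u" "u \<noteq> 0"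
      using 2 assms(2) by (metis Reals_cases Reals_diff eq_iff_diff_eq_0 of_real_0 union_single_eq_member)
    have "1 / u\<^sup>2 + r > 0" using u(2) r(1) by (simp add: add_pos_nonneg)
    moreover have "(\<Sum>a\<in>#add_mset a A. 1 / (c - a)\<^sup>2) = complex_of_real (1 / u\<^sup>2 + r)"
      by (simp add: r(2) u(1))
    ultimately show ?case by (intro exI[of _ "1 / u\<^sup>2 + r"]) auto
  }
qed auto

text \<open>Laguerre's inequality \<open>P'\<^sup>2 - P P'' > 0\<close> for \<open>P = T - y\<close> at a critical point \<open>c\<close>: the sign of \<open>T''(c)\<close>,
  after division by the square of the leading coefficient, is that of \<open>y - T(c)\<close>. So real fibres over
  two values \<open>y\<close> on different sides of \<open>T(c)\<close> are incompatible.\<close>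

lemma critical_point_real_fibre:
  fixes T :: "complex poly"
  assumes deg: "degree T > 0" and real: "\<And>z. poly T z = y \<Longrightarrow> z \<in> \<real>"
    and c: "c \<in> \<real>" "poly (pderiv T) c = 0" "poly T c \<noteq> y"
  obtains r :: real where "r > 0"
    "(y - poly T c) * (poly (pderiv (pderiv T)) c / (lead_coeff T)\<^sup>2) = complex_of_real r"
proof -
  let ?Q = "T - [:y:]" and ?a = "lead_coeff T"
  let ?P = "\<Prod>a\<in>#proots ?Q. [:-a, 1:]"
  have a: "?a \<noteq> 0" using deg by auto
  have Q0: "?Q \<noteq> 0" using deg by auto
  have dQ: "degree ?Q = degree T" using deg by (simp add: degree_diff_eq_left)
  then have "lead_coeff ?Q = ?a" using deg by (cases "degree T") auto
  then have Q: "?Q = Polynomial.smult ?a ?P" using complex_poly_decompose_multiset[of ?Q] by simp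
  have T: "T = [:y:] + Polynomial.smult ?a ?P" using Q by (metis add.commute diff_add_cancel)
  have T0: "poly T c = y + ?a * poly ?P c" by (subst T) simp
  have T1: "pderiv T = Polynomial.smult ?a (pderiv ?P)"
    by (subst T) (simp add: pderiv_add pderiv_smult)
  have T2: "poly (pderiv (pderiv T)) c = ?a * poly (pderiv (pderiv ?P)) c"
    unfolding T1 by (simp add: pderiv_smult)
  have P1: "poly (pderiv ?P) c = 0" using c(2) a unfolding T1 by simp
  have "proots ?Q \<noteq> {#}" using dQ deg size_proots_complex[of ?Q] by auto
  moreover have "a \<in> \<real>" if "a \<in># proots ?Q" for a using that Q0 real by auto
  moreover have nin: "c \<notin># proots ?Q" using Q0 c(3) by auto
  ultimately obtain r where r: "r > 0" "(\<Sum>a\<in>#proots ?Q. 1 / (c - a)\<^sup>2) = complex_of_real r"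
    and "poly ?P c \<in> \<real> - {0}"
    using prod_linear_real_roots[of "proots ?Q" c] c(1) by blast
  then obtain s where s: "poly ?P c = complex_of_real s" "s \<noteq> 0"
    by (auto elim!: Reals_cases)
  have "- poly ?P c * poly (pderiv (pderiv ?P)) c = complex_of_real (s\<^sup>2 * r)"
    using pderiv_prod_linear(2)[OF nin] unfolding P1 r(2) by (simp add: s(1))
  moreover have "(y - poly T c) * (poly (pderiv (pderiv T)) c / ?a\<^sup>2)
      = - poly ?P c * poly (pderiv (pderiv ?P)) c"
    unfolding T0 T2 using a by (simp add: power2_eq_square)
  moreover have "s\<^sup>2 * r > 0" using r(1) s(2) by simp
  ultimately show ?thesis using that by metis
qed

lemma card_simple_fibre:
  fixes T :: "complex poly"
  assumes deg: "degree T > 0" and simple: "\<And>z. poly T z = x \<Longrightarrow> poly (pderiv T) z \<noteq> 0"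
  shows "card {z. poly T z = x} = degree T"
    and "T - [:x:] = Polynomial.smult (lead_coeff T) (\<Prod>z | poly T z = x. [:-z, 1:])"
proof -
  let ?Q = "T - [:x:]"
  have dQ: "degree ?Q = degree T" using deg by (simp add: degree_diff_eq_left)
  then have lQ: "lead_coeff ?Q = lead_coeff T" using deg by (cases "degree T") auto
  have "rsquarefree ?Q" using simple by (auto simp: rsquarefree_roots pderiv_diff pderiv_pCons)
  from complex_poly_decompose_rsquarefree[OF this]
  show eq: "?Q = Polynomial.smult (lead_coeff T) (\<Prod>z | poly T z = x. [:-z, 1:])"
    unfolding lQ by simp
  have "degree ?Q = degree (\<Prod>z | poly T z = x. [:-z, 1:])"
    unfolding eq using deg by auto
  also have "\<dots> = card {z. poly T z = x}" by (subst degree_prod_sum_eq) auto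
  finally show "card {z. poly T z = x} = degree T" using dQ by simp
qed

section \<open>Polynomials with real coefficients\<close>

definition real_coeffs :: "complex poly \<Rightarrow> bool" where
  "real_coeffs p \<longleftrightarrow> (\<forall>i. coeff p i \<in> \<real>)"

lemma real_coeffs_poly: "real_coeffs p \<Longrightarrow> z \<in> \<real> \<Longrightarrow> poly p z \<in> \<real>"
  unfolding real_coeffs_def poly_altdef by (intro sum_in_Reals Reals_mult Reals_power) auto

lemma real_coeffs_prod_linear:
  assumes "finite A" "\<And>a. a \<in> A \<Longrightarrow> a \<in> \<real>"
  shows "real_coeffs (\<Prod>a\<in>A. [:-a, 1:])"
  using assms
proof (induction A rule: finite_induct)
  case (insert a A)
  then show ?case
    by (auto simp: real_coeffs_def coeff_pCons split: nat.splits
        intro!: Reals_mult Reals_add Reals_minus)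
qed (auto simp: real_coeffs_def coeff_pCons split: nat.splits)

lemma real_coeffs_pderiv: "real_coeffs p \<Longrightarrow> real_coeffs (pderiv p)"
  unfolding real_coeffs_def coeff_pderiv by (auto intro!: Reals_mult)

lemma real_coeffs_pcompose:
  assumes p: "real_coeffs p" and q: "real_coeffs q"
  shows "real_coeffs (pcompose p q)"
  using p
proof (induction p)
  case (pCons a p)
  have a: "a \<in> \<real>" using pCons.prems unfolding real_coeffs_def by (metis coeff_pCons_0)
  have "real_coeffs p" using pCons.prems unfolding real_coeffs_def by (metis coeff_pCons_Suc)
  then have "real_coeffs (pcompose p q)" by (rule pCons.IH)
  then show ?case
    using a q unfolding real_coeffs_def pcompose_pCons coeff_add coeff_mult coeff_pCons
    by (auto intro!: Reals_add sum_in_Reals Reals_mult split: nat.splits)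
qed simp


section \<open>The Ruelle operator of a composition\<close>

lemma finite_fibre:
  fixes T :: "complex poly"
  assumes "degree T > 0" shows "finite {z. poly T z = x}"
proof -
  have "finite {z. poly (T - [:x:]) z = 0}" using assms by (intro poly_roots_finite) auto
  then show ?thesis by simp
qed

text \<open>The product of the distances from a root over \<open>x0\<close> to all roots over \<open>x\<close> is \<open>|x - x0|\<close> divided by the
  modulus of the leading coefficient. Hence, for \<open>x\<close> near \<open>x0\<close>, each root over \<open>x0\<close> has a root over \<open>x\<close>
  nearby, and since both fibres have \<open>degree T\<close> points, this matches the two fibres bijectively.\<close>

lemma continuous_on_fibre_sum:
  fixes T :: "complex poly" and I :: "complex set" and h :: "complex \<Rightarrow> complex"
  assumes deg: "degree T > 0"
    and simple: "\<And>y. poly T y \<in> I \<Longrightarrow> poly (pderiv T) y \<noteq> 0"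
    and h: "continuous_on (poly T -` I) h"
  shows "continuous_on I (\<lambda>x. \<Sum>y | poly T y = x. h y)"
  unfolding continuous_on_iff
proof (intro ballI allI impI)
  fix x0 e assume x0: "x0 \<in> I" and e: "(e::real) > 0"
  define d where "d = degree T"
  define fib where "fib = (\<lambda>x. {y. poly T y = x})"
  have fin: "finite (fib x)" for x using finite_fibre[OF deg] by (simp add: fib_def)
  have card: "card (fib x) = d"
    and fact: "T - [:x:] = Polynomial.smult (lead_coeff T) (\<Prod>z\<in>fib x. [:-z, 1:])" if "x \<in> I" for x
    using card_simple_fibre[OF deg, of x] simple that by (auto simp: fib_def d_def)
  have d: "d > 0" using deg by (simp add: d_def)
  have a: "lead_coeff T \<noteq> 0" using deg by auto
  have "\<exists>\<delta>>0. \<forall>y. poly T y \<in> I \<longrightarrow> dist y l < \<delta> \<longrightarrow> dist (h y) (h l) < e / (2 * d)"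
    if "l \<in> fib x0" for l
  proof -
    have "l \<in> poly T -` I" "e / (2 * d) > 0" using that x0 e d by (auto simp: fib_def)
    then obtain \<delta> where "\<delta> > 0" "\<forall>y\<in>poly T -` I. dist y l < \<delta> \<longrightarrow> dist (h y) (h l) < e / (2 * d)"
      using h unfolding continuous_on_iff by blast
    then show ?thesis by (intro exI[of _ \<delta>]) auto
  qed
  then obtain \<delta> where \<delta>: "\<And>l. l \<in> fib x0 \<Longrightarrow> \<delta> l > 0"
    "\<And>l y. l \<in> fib x0 \<Longrightarrow> poly T y \<in> I \<Longrightarrow> dist y l < \<delta> l \<Longrightarrow> dist (h y) (h l) < e / (2 * d)"
    by metis
  have "\<exists>s>0. \<forall>m\<in>fib x0. m \<noteq> l \<longrightarrow> s \<le> dist l m" for l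
    using finite_set_avoid[OF fin[of x0], of l] by blast
  then obtain s where s: "\<And>l. s l > 0" "\<And>l m. m \<in> fib x0 \<Longrightarrow> m \<noteq> l \<Longrightarrow> s l \<le> dist l m"
    by metis
  \<comment> \<open>a common radius, at most half the separation of the roots; the element 1 only keeps the
    minimum over a nonempty set\<close>
  define r where "r = Min (insert 1 ((\<lambda>l. min (\<delta> l) (s l / 2)) ` fib x0))"
  have r0: "r > 0" unfolding r_def using fin \<delta>(1) s(1) by (subst Min_gr_iff) auto
  have r1: "r \<le> \<delta> l" "r \<le> s l / 2" if "l \<in> fib x0" for l
  proof -
    have "r \<le> min (\<delta> l) (s l / 2)" unfolding r_def using fin that by (intro Min_le) auto
    then show "r \<le> \<delta> l" "r \<le> s l / 2" by auto
  qed
  show "\<exists>\<eta>>0. \<forall>x\<in>I. dist x x0 < \<eta> \<longrightarrow>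
      dist (\<Sum>y | poly T y = x. h y) (\<Sum>y | poly T y = x0. h y) < e"
  proof (intro exI[of _ "norm (lead_coeff T) * r ^ d"] conjI ballI impI)
    show "norm (lead_coeff T) * r ^ d > 0" using a r0 by simp
    fix x assume x: "x \<in> I" and close: "dist x x0 < norm (lead_coeff T) * r ^ d"
    have "\<exists>y. poly T y = x \<and> dist y l < r" if l: "l \<in> fib x0" for l
    proof (rule ccontr)
      assume no: "\<not> ?thesis"
      have "r ^ d \<le> (\<Prod>y\<in>fib x. dist l y)"
      proof -
        have "(\<Prod>y\<in>fib x. r) \<le> (\<Prod>y\<in>fib x. dist l y)"
          using no r0 by (intro prod_mono) (auto simp: fib_def not_less dist_commute)
        then show ?thesis using card[OF x] by simp
      qed
      also have "\<dots> = norm (\<Prod>y\<in>fib x. l - y)" by (simp add: prod_norm dist_norm)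
      finally have "norm (lead_coeff T) * r ^ d \<le> norm (lead_coeff T * (\<Prod>y\<in>fib x. l - y))"
        by (simp add: norm_mult mult_left_mono)
      also have "lead_coeff T * (\<Prod>y\<in>fib x. l - y) = poly (T - [:x:]) l"
        unfolding fact[OF x] by (simp add: poly_prod)
      also have "\<dots> = x0 - x" using l by (simp add: fib_def)
      finally show False using close by (simp add: dist_norm norm_minus_commute)
    qed
    then obtain f where f: "\<And>l. l \<in> fib x0 \<Longrightarrow> poly T (f l) = x"
      "\<And>l. l \<in> fib x0 \<Longrightarrow> dist (f l) l < r" by metis
    have inj: "inj_on f (fib x0)"
    proof (rule inj_onI, rule ccontr)
      fix l m assume lm: "l \<in> fib x0" "m \<in> fib x0" "f l = f m" "l \<noteq> m"
      have "dist l m \<le> dist (f l) l + dist (f l) m"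
        using dist_triangle[of l m "f l"] by (simp add: dist_commute)
      also have "\<dots> < r + r" using f(2)[OF lm(1)] f(2)[OF lm(2)] lm(3) by (intro add_strict_mono) simp_all
      also have "\<dots> \<le> s l" using r1(2)[OF lm(1)] by simp
      also have "\<dots> \<le> dist l m" using s(2)[of m l] lm by auto
      finally show False by simp
    qed
    have img: "f ` fib x0 = fib x"
      by (rule card_subset_eq[OF fin]) (use f(1) card x x0 card_image[OF inj] in \<open>auto simp: fib_def\<close>)
    have "(\<Sum>y\<in>fib x. h y) - (\<Sum>y\<in>fib x0. h y) = (\<Sum>l\<in>fib x0. h (f l) - h l)"
      unfolding img[symmetric] by (simp add: sum.reindex[OF inj] sum_subtractf)
    also have "norm \<dots> \<le> (\<Sum>l\<in>fib x0. e / (2 * d))"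
    proof (rule sum_norm_le)
      fix l assume l: "l \<in> fib x0"
      have "dist (h (f l)) (h l) < e / (2 * d)"
        using f(1,2)[OF l] r1(1)[OF l] x by (intro \<delta>(2) l) auto
      then show "norm (h (f l) - h l) \<le> e / (2 * d)" by (simp add: dist_norm)
    qed
    also have "\<dots> = e / 2" using card[OF x0] d by simp
    also have "\<dots> < e" using e by simp
    finally show "dist (\<Sum>y | poly T y = x. h y) (\<Sum>y | poly T y = x0. h y) < e"
      by (simp add: dist_norm fib_def)
  qed
qed

lemma sum_fibre_pcompose:
  fixes P Q :: "complex poly"
  assumes "degree P > 0" "degree Q > 0"
  shows "(\<Sum>y | poly (pcompose P Q) y = x. f y)
    = (\<Sum>z | poly P z = x. \<Sum>y | poly Q y = z. (f y :: complex))"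
proof -
  have fin: "finite {y. poly (pcompose P Q) y = x}" "finite {z. poly P z = x}"
    using finite_fibre[of "pcompose P Q" x] finite_fibre[of P x] assms by simp_all
  have "(\<Sum>z | poly P z = x. \<Sum>y | poly Q y = z. f y)
    = (\<Sum>z | poly P z = x. \<Sum>y\<in>{y \<in> {y. poly (pcompose P Q) y = x}. poly Q y = z}. f y)"
    by (intro sum.cong) (auto simp: poly_pcompose)
  also have "\<dots> = (\<Sum>y | poly (pcompose P Q) y = x. f y)"
    by (rule sum.group[OF fin]) (auto simp: poly_pcompose)
  finally show ?thesis by simp
qed

lemma ruelle2_cong:
  assumes "\<And>y. poly T y \<in> I \<Longrightarrow> g y = h y"
  shows "ruelle2 T I g = ruelle2 T I h"
  unfolding ruelle2_def by (intro restrict_ext arg_cong2[where f = "(*)"] refl sum.cong) (use assms in auto)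

text \<open>The fibre of \<open>P \<circ> Q\<close> is the union of the fibres of \<open>Q\<close> over the fibre of \<open>P\<close>, and the weights multiply
  by the chain rule. In particular the Ruelle operators of the iterates are the powers of one
  operator.\<close>

lemma ruelle2_pcompose:
  assumes "degree P > 0" "degree Q > 0" and "\<And>y. poly P y \<in> I \<Longrightarrow> y \<in> I"
  shows "ruelle2 (pcompose P Q) I g = ruelle2 P I (ruelle2 Q I g)"
proof
  fix x
  have "(\<Sum>z | poly P z = x. (\<Sum>y | poly Q y = z. g y / (poly (pderiv (pcompose P Q)) y)\<^sup>2))
      = (\<Sum>z | poly P z = x. (of_nat (degree Q) * ruelle2 Q I g z) / (poly (pderiv P) z)\<^sup>2)"
    if "x \<in> I"
  proof (rule sum.cong[OF refl])
    fix z assume "z \<in> {z. poly P z = x}"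
    then have z: "z \<in> I" using assms(3) that by auto
    have "(\<Sum>y | poly Q y = z. g y / (poly (pderiv (pcompose P Q)) y)\<^sup>2)
        = (\<Sum>y | poly Q y = z. g y / (poly (pderiv Q) y)\<^sup>2 / (poly (pderiv P) z)\<^sup>2)"
      by (intro sum.cong refl) (auto simp: pderiv_pcompose poly_pcompose power_mult_distrib mult.commute)
    also have "\<dots> = (\<Sum>y | poly Q y = z. g y / (poly (pderiv Q) y)\<^sup>2) / (poly (pderiv P) z)\<^sup>2"
      by (simp only: sum_divide_distrib)
    also have "\<dots> = (of_nat (degree Q) * ruelle2 Q I g z) / (poly (pderiv P) z)\<^sup>2"
      using z assms(2) by (simp add: ruelle2_def)
    finally show "(\<Sum>y | poly Q y = z. g y / (poly (pderiv (pcompose P Q)) y)\<^sup>2)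
        = (of_nat (degree Q) * ruelle2 Q I g z) / (poly (pderiv P) z)\<^sup>2" .
  qed
  then have "(\<Sum>y | poly (pcompose P Q) y = x. g y / (poly (pderiv (pcompose P Q)) y)\<^sup>2)
      = of_nat (degree Q) * (\<Sum>z | poly P z = x. ruelle2 Q I g z / (poly (pderiv P) z)\<^sup>2)"
    if "x \<in> I"
    using that by (simp add: sum_fibre_pcompose[OF assms(1,2)] sum_distrib_left del: poly_pcompose)
  then show "ruelle2 (pcompose P Q) I g x = ruelle2 P I (ruelle2 Q I g) x"
    using assms(2) unfolding ruelle2_def[of "pcompose P Q"] ruelle2_def[of P]
    by (cases "x \<in> I") simp_all
qed

lemma schwarzian_pcompose:
  assumes "poly (pderiv Q) y \<noteq> 0" "poly (pderiv P) (poly Q y) \<noteq> 0"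
  shows "schwarzian (pcompose P Q) y
    = schwarzian P (poly Q y) * (poly (pderiv Q) y)\<^sup>2 + schwarzian Q y"
  using assms unfolding schwarzian_def
  by (simp add: pderiv_pcompose pderiv_mult pderiv_add poly_pcompose divide_simps)
     (simp add: power2_eq_square algebra_simps)

text \<open>In the cocycle identity \<open>schwarzian_pcompose\<close> the factor \<open>Q'\<^sup>2\<close> cancels against the weight, so the first
  term is constant on the fibres of \<open>Q\<close> and averages to \<open>schwarzian P\<close>.\<close>

lemma ruelle2_schwarzian_pcompose:
  assumes deg: "degree P > 0" "degree Q > 0"
    and inv: "\<And>y. poly P y \<in> I \<Longrightarrow> y \<in> I"
    and P': "\<And>y. poly P y \<in> I \<Longrightarrow> poly (pderiv P) y \<noteq> 0"
    and Q': "\<And>y. poly Q y \<in> I \<Longrightarrow> poly (pderiv Q) y \<noteq> 0"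
    and x: "x \<in> I"
  shows "ruelle2 (pcompose P Q) I (schwarzian (pcompose P Q)) x
    = ruelle2 P I (schwarzian P) x + ruelle2 P I (ruelle2 Q I (schwarzian Q)) x"
proof -
  have "(\<Sum>y | poly Q y = z. schwarzian (pcompose P Q) y / (poly (pderiv (pcompose P Q)) y)\<^sup>2)
      = of_nat (degree Q) * ((schwarzian P z + ruelle2 Q I (schwarzian Q) z) / (poly (pderiv P) z)\<^sup>2)"
    if "poly P z = x" for z
  proof -
    have zI: "z \<in> I" and Pz: "poly (pderiv P) z \<noteq> 0" using inv P' that x by auto
    have "(\<Sum>y | poly Q y = z. schwarzian (pcompose P Q) y / (poly (pderiv (pcompose P Q)) y)\<^sup>2)
      = (\<Sum>y | poly Q y = z. (schwarzian P z + schwarzian Q y / (poly (pderiv Q) y)\<^sup>2)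
           / (poly (pderiv P) z)\<^sup>2)"
    proof (intro sum.cong refl)
      fix y assume "y \<in> {y. poly Q y = z}"
      then have y: "poly Q y = z" by simp
      then have Qy: "poly (pderiv Q) y \<noteq> 0" using Q' zI by auto
      show "schwarzian (pcompose P Q) y / (poly (pderiv (pcompose P Q)) y)\<^sup>2
        = (schwarzian P z + schwarzian Q y / (poly (pderiv Q) y)\<^sup>2) / (poly (pderiv P) z)\<^sup>2"
        using schwarzian_pcompose[OF Qy, of P] Pz Qy y
        by (simp add: pderiv_pcompose poly_pcompose power_mult_distrib divide_simps)
    qed
    also have "\<dots> = (of_nat (card {y. poly Q y = z}) * schwarzian P z
        + of_nat (degree Q) * ruelle2 Q I (schwarzian Q) z) / (poly (pderiv P) z)\<^sup>2"
      using zI deg(2) by (simp add: sum_divide_distrib[symmetric] sum.distrib ruelle2_def)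
    also have "card {y. poly Q y = z} = degree Q"
      using Q' zI by (intro card_simple_fibre deg) auto
    finally show ?thesis by (simp add: algebra_simps)
  qed
  then have "(\<Sum>y | poly (pcompose P Q) y = x.
        schwarzian (pcompose P Q) y / (poly (pderiv (pcompose P Q)) y)\<^sup>2)
      = of_nat (degree Q) * (\<Sum>z | poly P z = x.
          (schwarzian P z + ruelle2 Q I (schwarzian Q) z) / (poly (pderiv P) z)\<^sup>2)"
    unfolding sum_fibre_pcompose[OF deg] sum_distrib_left by (intro sum.cong) auto
  then show ?thesis
    using x deg unfolding ruelle2_def[of "pcompose P Q"] ruelle2_def[of P]
    by (simp add: sum.distrib add_divide_distrib distrib_left)
qed


section \<open>Expanding polynomials with real Julia set\<close>

locale expanding_real_julia =
  fixes T :: "complex poly" and \<xi> :: real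
  assumes degree_ge_2: "degree T \<ge> 2"
    and expanding: "expanding T"
    and julia_real: "julia T \<subseteq> \<real>"
    and hull: "convex hull (julia T) = sym_interval \<xi>"
    and vimage: "poly T -` sym_interval \<xi> \<subseteq> sym_interval \<xi>"
begin

abbreviation I :: "complex set" where "I \<equiv> sym_interval \<xi>"

lemma interval_real: "x \<in> I \<Longrightarrow> x \<in> \<real>"
  by (auto simp: sym_interval_def)

lemma compact_interval: "compact I"
  unfolding sym_interval_def by (intro compact_continuous_image continuous_intros compact_Icc)

lemma degree_pos: "degree T > 0"
  using degree_ge_2 by simp

lemma filled_eq: "filled_julia T = julia T"
  using filled_julia_eq_julia degree_ge_2 julia_real by blast

subsection \<open>Fibres over the interval are real and simple\<close>

lemma xi_nonneg: "\<xi> \<ge> 0"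
proof -
  have "julia T \<noteq> {}" using filled_julia_nonempty[OF degree_ge_2] filled_eq by simp
  then have "I \<noteq> {}" unfolding hull[symmetric] by simp
  then show ?thesis by (auto simp: sym_interval_def)
qed

text \<open>Without this endpoint the interval would be a smaller convex set that contains the Julia set.\<close>

lemma endpoint_in_julia:
  assumes "t \<in> {-\<xi>, \<xi>}" shows "complex_of_real t \<in> julia T"
proof (rule ccontr)
  assume no: "complex_of_real t \<notin> julia T"
  let ?S = "{-\<xi>..\<xi>} - {t}"
  have "?S = {-\<xi><..\<xi>} \<or> ?S = {-\<xi>..<\<xi>}" using assms by auto
  then have "convex ?S" by (metis convex_real_interval(5,7,6,8))
  then have conv: "convex (complex_of_real ` ?S)"
    by (intro convex_linear_image bounded_linear.linear bounded_linear_of_real)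
  have "julia T \<subseteq> I" unfolding hull[symmetric] by (rule hull_subset)
  then have "julia T \<subseteq> complex_of_real ` ?S" using no by (auto simp: sym_interval_def)
  then have "I \<subseteq> complex_of_real ` ?S" unfolding hull[symmetric] using conv by (rule hull_minimal)
  moreover have "complex_of_real t \<in> I" using assms xi_nonneg by (auto simp: sym_interval_def)
  ultimately show False by auto
qed

lemma deriv_nonzero_julia: "c \<in> julia T \<Longrightarrow> poly (pderiv T) c \<noteq> 0"
proof -
  assume c: "c \<in> julia T"
  obtain A k :: real where "A > 0" "k > 1"
    and *: "\<And>z n. z \<in> julia T \<Longrightarrow> n \<ge> 1 \<Longrightarrow> norm (poly (pderiv (poly_iterate T n)) z) \<ge> A * k ^ n"
    using expanding unfolding expanding_def by blast
  have "poly_iterate T 1 = T" by (simp add: poly_iterate_Suc pcompose_idR)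
  then have "norm (poly (pderiv T) c) \<ge> A * k" using *[OF c, of 1] by simp
  moreover have "A * k > 0" using \<open>A > 0\<close> \<open>k > 1\<close> by simp
  ultimately show ?thesis by auto
qed

text \<open>If \<open>T(c)\<close> lies in the Julia set, so does \<open>c\<close>, and expansion applies; this covers the endpoints.
  Otherwise \<open>T(c)\<close> is strictly between the endpoints. Both endpoints have real fibres, and
  \<open>critical_point_real_fibre\<close> asks for \<open>T''(c)\<close> with opposite signs.\<close>

lemma deriv_nonzero:
  assumes c: "poly T c \<in> I" shows "poly (pderiv T) c \<noteq> 0"
proof (cases "poly T c \<in> julia T")
  case True
  then have "c \<in> julia T" using filled_julia_vimage filled_eq by metis
  then show ?thesis by (rule deriv_nonzero_julia)
next
  case False
  obtain \<tau> where \<tau>: "poly T c = complex_of_real \<tau>" "\<tau> \<in> {-\<xi>..\<xi>}"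
    using c by (auto simp: sym_interval_def)
  have "\<tau> \<notin> {-\<xi>, \<xi>}" using False \<tau>(1) endpoint_in_julia by metis
  then have \<tau>_open: "-\<xi> < \<tau>" "\<tau> < \<xi>" using \<tau>(2) by auto
  show ?thesis
  proof
    assume crit: "poly (pderiv T) c = 0"
    have "c \<in> \<real>" using c vimage interval_real by blast
    define w where "w = poly (pderiv (pderiv T)) c / (lead_coeff T)\<^sup>2"
    have pos: "(t - \<tau>) * Re w > 0" if "t \<in> {-\<xi>, \<xi>}" for t
    proof -
      have "complex_of_real t \<in> I" using that xi_nonneg by (auto simp: sym_interval_def)
      then have real: "z \<in> \<real>" if "poly T z = complex_of_real t" for z
        using vimage interval_real that by (metis subsetD vimageI)
      have "poly T c \<noteq> complex_of_real t" using that \<tau>_open \<tau>(1) by auto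
      from critical_point_real_fibre[OF degree_pos real \<open>c \<in> \<real>\<close> crit this]
      obtain r where r: "r > 0" "(complex_of_real t - poly T c) * w = complex_of_real r"
        unfolding w_def by blast
      have "(t - \<tau>) * Re w = Re ((complex_of_real t - poly T c) * w)" by (simp add: \<tau>(1))
      also have "\<dots> = r" by (simp add: r(2))
      finally show ?thesis using r(1) by simp
    qed
    have "Re w > 0" using pos[of \<xi>] \<tau>_open by (simp add: zero_less_mult_iff)
    moreover have "Re w < 0" using pos[of "-\<xi>"] \<tau>_open by (simp add: zero_less_mult_iff)
    ultimately show False by simp
  qed
qed

lemma xi_pos: "\<xi> > 0"
proof (rule ccontr)
  assume "\<not> \<xi> > 0"
  then have I: "I = {0}" using xi_nonneg by (auto simp: sym_interval_def)
  then have "card {z. poly T z = 0} = degree T"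
    by (intro card_simple_fibre degree_pos deriv_nonzero) auto
  moreover have "card {z. poly T z = 0} \<le> card {0::complex}"
    using vimage unfolding I by (intro card_mono) auto
  ultimately show False using degree_ge_2 by simp
qed

text \<open>Up to the leading coefficient, \<open>T - \<xi>\<close> and \<open>T + \<xi>\<close> are products over real roots. They differ by the
  nonzero real number \<open>2\<xi>\<close>, so the leading coefficient is real as well.\<close>

lemma real_coeffs: "real_coeffs T"
proof -
  let ?a = "lead_coeff T"
  let ?P = "\<lambda>x. \<Prod>z | poly T z = complex_of_real x. [:-z, 1:]"
  have inI: "complex_of_real x \<in> I" if "x \<in> {-\<xi>, \<xi>}" for x
    using that xi_nonneg by (auto simp: sym_interval_def)
  have T: "T - [:complex_of_real x:] = Polynomial.smult ?a (?P x)" if "x \<in> {-\<xi>, \<xi>}" for x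
    using inI[OF that] by (intro card_simple_fibre degree_pos deriv_nonzero) auto
  have P: "real_coeffs (?P x)" if "x \<in> {-\<xi>, \<xi>}" for x
    using vimage inI[OF that] finite_fibre[OF degree_pos]
    by (intro real_coeffs_prod_linear) (auto intro: interval_real)
  have "?a \<in> \<real>"
  proof -
    define u where "u = coeff (?P (-\<xi>)) 0 - coeff (?P \<xi>) 0"
    have "u \<in> \<real>" using P[of \<xi>] P[of "-\<xi>"] unfolding u_def real_coeffs_def by (intro Reals_diff) auto
    have "coeff T 0 - complex_of_real x = ?a * coeff (?P x) 0" if "x \<in> {-\<xi>, \<xi>}" for x
      using arg_cong[OF T[OF that], of "\<lambda>p. coeff p 0"] by simp
    from this[of "-\<xi>"] this[of \<xi>] have "complex_of_real (2 * \<xi>) = ?a * u"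
      by (simp add: u_def algebra_simps)
    moreover from this have "u \<noteq> 0" using xi_pos by auto
    ultimately have "?a = complex_of_real (2 * \<xi>) / u" by (simp add: field_simps)
    then show ?thesis using \<open>u \<in> \<real>\<close> by (simp del: of_real_mult)
  qed
  have "T = [:complex_of_real \<xi>:] + Polynomial.smult ?a (?P \<xi>)"
    using T[of \<xi>] by (metis add.commute diff_add_cancel insertCI)
  moreover have "real_coeffs \<dots>"
    using P[of \<xi>] \<open>?a \<in> \<real>\<close> unfolding real_coeffs_def
    by (auto simp: coeff_pCons split: nat.splits intro!: Reals_add Reals_mult)
  ultimately show ?thesis by simp
qed

subsection \<open>Exponential growth of the derivatives\<close>

lemma iterate_vimage: "poly (poly_iterate T n) y \<in> I \<Longrightarrow> y \<in> I"
proof (induction n)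
  case (Suc n)
  then have "poly T (poly (poly_iterate T n) y) \<in> I" by (simp add: poly_iterate_Suc poly_pcompose)
  then show ?case using Suc.IH vimage by blast
qed simp

lemma iterate_antimono:
  assumes "m \<le> n" "poly (poly_iterate T n) y \<in> I" shows "poly (poly_iterate T m) y \<in> I"
  using assms iterate_vimage[of "n - m" "poly (poly_iterate T m) y"] poly_iterate_add[of T "n - m" m]
  by (simp add: poly_pcompose)

lemma iterate_deriv:
  assumes "poly (poly_iterate T n) y \<in> I"
  shows "poly (pderiv (poly_iterate T n)) y \<in> \<real> - {0}"
  using assms
proof (induction n)
  case (Suc n)
  let ?w = "poly (poly_iterate T n) y"
  have w: "poly T ?w \<in> I" using Suc.prems by (simp add: poly_iterate_Suc poly_pcompose)
  then have "?w \<in> I" using vimage by blast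
  then have IH: "poly (pderiv (poly_iterate T n)) y \<in> \<real> - {0}" by (rule Suc.IH)
  have "poly (pderiv T) ?w \<in> \<real>"
    using real_coeffs real_coeffs_pderiv real_coeffs_poly interval_real[OF \<open>?w \<in> I\<close>] by blast
  then show ?case using IH deriv_nonzero[OF w]
    by (simp add: poly_iterate_Suc pderiv_pcompose poly_pcompose)
qed (simp add: pderiv_pCons)

lemma degree_iterate_pos: "degree (poly_iterate T n) > 0"
  using degree_ge_2 by (simp add: degree_poly_iterate)

lemma compact_iterate_vimage: "compact (poly (poly_iterate T n) -` I)"
proof -
  have "closed (poly (poly_iterate T n) -` I)"
    by (intro continuous_closed_vimage compact_imp_closed compact_interval) auto
  then have "compact (I \<inter> poly (poly_iterate T n) -` I)"
    by (intro compact_Int_closed compact_interval)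
  also have "I \<inter> poly (poly_iterate T n) -` I = poly (poly_iterate T n) -` I"
    using iterate_vimage by auto
  finally show ?thesis .
qed

text \<open>Expansion holds on the Julia set; by compactness some iterate expands on a neighbourhood,
  and this neighbourhood contains the nested preimages of the interval from some level on, because
  their intersection consists of points with bounded orbit.\<close>

lemma iterate_deriv_expands:
  obtains N m where "m \<ge> 1"
    "\<And>y. poly (poly_iterate T N) y \<in> I \<Longrightarrow> norm (poly (pderiv (poly_iterate T m)) y) > 2"
proof -
  obtain A c :: real where A: "A > 0" "c > 1"
    and exp: "\<And>z n. z \<in> julia T \<Longrightarrow> n \<ge> 1 \<Longrightarrow> norm (poly (pderiv (poly_iterate T n)) z) \<ge> A * c ^ n"
    using expanding unfolding expanding_def by blast
  obtain k where "2 / A < c ^ k" using real_arch_pow[OF A(2)] by blast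
  also have "\<dots> < c ^ Suc k" using A(2) by (intro power_strict_increasing) auto
  finally have k: "2 < A * c ^ Suc k" using A(1) by (simp add: field_simps)
  define D where "D = (\<lambda>y. norm (poly (pderiv (poly_iterate T (Suc k))) y))"
  define F where "F = (\<lambda>n. poly (poly_iterate T n) -` I \<inter> {y. D y \<le> 2})"
  have "\<exists>N. F N = {}"
  proof (rule ccontr)
    assume ne: "\<not> (\<exists>N. F N = {})"
    have "closed {y. D y \<le> 2}" unfolding D_def by (intro closed_Collect_le continuous_intros)
    then have "compact (F n)" for n
      unfolding F_def by (intro compact_Int_closed compact_iterate_vimage)
    moreover have "F n \<subseteq> F m" if "m \<le> n" for m n
      unfolding F_def using iterate_antimono[OF that] by auto
    ultimately have "\<Inter>(range F) \<noteq> {}" using ne by (intro compact_nest) auto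
    then obtain y where y: "\<And>n. y \<in> F n" by auto
    have "range (\<lambda>n. poly (poly_iterate T n) y) \<subseteq> I" using y by (auto simp: F_def)
    then have "y \<in> filled_julia T"
      unfolding filled_julia_def
      using bounded_subset compact_imp_bounded[OF compact_interval] by blast
    then have "D y \<ge> A * c ^ Suc k" unfolding D_def filled_eq by (rule exp) simp
    then show False using k y[of 0] by (simp add: F_def)
  qed
  then obtain N where "F N = {}" ..
  then have "D y > 2" if "poly (poly_iterate T N) y \<in> I" for y
    using that by (auto simp: F_def not_le)
  then show ?thesis using that[of "Suc k" N] by (auto simp: D_def)
qed

text \<open>From some level on, \<open>m\<close> more steps divide \<open>1/T\<^sub>n'\<^sup>2\<close> by at least \<open>4\<close>. The first levels are bounded by
  compactness, which uses that \<open>T\<^sub>n'\<close> has no zero on \<open>T\<^sub>n\<^sup>-\<^sup>1(I)\<close>.\<close>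

lemma iterate_deriv_decay:
  obtains \<rho> C :: real where "0 < \<rho>" "\<rho> < 1" "0 < C"
    "\<forall>n y. poly (poly_iterate T n) y \<in> I \<longrightarrow>
       norm (1 / (poly (pderiv (poly_iterate T n)) y)\<^sup>2) \<le> C * \<rho> ^ n"
proof -
  define w where "w = (\<lambda>n y. norm (1 / (poly (pderiv (poly_iterate T n)) y)\<^sup>2))"
  have ex: "\<forall>n. \<exists>B. \<forall>y. poly (poly_iterate T n) y \<in> I \<longrightarrow> w n y \<le> B"
  proof
    fix n
    have "continuous_on (poly (poly_iterate T n) -` I)
        (\<lambda>y. 1 / (poly (pderiv (poly_iterate T n)) y)\<^sup>2)"
      using iterate_deriv by (intro continuous_intros) auto
    then have "bounded ((\<lambda>y. 1 / (poly (pderiv (poly_iterate T n)) y)\<^sup>2) ` (poly (poly_iterate T n) -` I))"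
      by (intro compact_imp_bounded compact_continuous_image compact_iterate_vimage)
    then show "\<exists>B. \<forall>y. poly (poly_iterate T n) y \<in> I \<longrightarrow> w n y \<le> B"
      by (auto simp: bounded_iff w_def)
  qed
  from choice[OF ex]
  obtain B where B: "\<And>n y. poly (poly_iterate T n) y \<in> I \<Longrightarrow> w n y \<le> B n" by blast
  obtain N m where m: "m \<ge> 1"
    "\<And>y. poly (poly_iterate T N) y \<in> I \<Longrightarrow> norm (poly (pderiv (poly_iterate T m)) y) > 2"
    using iterate_deriv_expands by blast
  have rec: "w (n + m) y \<le> w n (poly (poly_iterate T m) y) / 4"
    if "n + m \<ge> N" "poly (poly_iterate T (n + m)) y \<in> I" for n y
  proof -
    let ?u = "norm (poly (pderiv (poly_iterate T m)) y)"
    have "?u > 2" using iterate_antimono[OF that] by (rule m(2))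
    then have "?u\<^sup>2 \<ge> 2\<^sup>2" by (intro power_mono) auto
    then have "inverse (?u\<^sup>2) \<le> inverse 4" by (intro le_imp_inverse_le) auto
    moreover have "w (n + m) y = w n (poly (poly_iterate T m) y) * inverse (?u\<^sup>2)"
      by (simp add: w_def poly_iterate_add pderiv_pcompose poly_pcompose norm_mult norm_divide
          norm_power power_mult_distrib divide_simps)
    moreover have "w n (poly (poly_iterate T m) y) \<ge> 0" by (simp add: w_def)
    ultimately have "w (n + m) y \<le> w n (poly (poly_iterate T m) y) * inverse 4"
      using mult_left_mono by metis
    then show ?thesis by simp
  qed
  \<comment> \<open>chosen such that \<open>\<rho> ^ m\<close> is the gain 1/4 of one block of \<open>m\<close> steps\<close>
  define \<rho> where "\<rho> = root m (1 / 4 :: real)"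
  have \<rho>m: "\<rho> ^ m = 1 / 4" using m(1) by (simp add: \<rho>_def)
  have \<rho>: "0 < \<rho>" "\<rho> < 1" using m(1) by (auto simp: \<rho>_def)
  define C where "C = 1 + (\<Sum>n<N + m. \<bar>B n\<bar> / \<rho> ^ n)"
  have C: "C > 0" unfolding C_def using \<rho> by (intro add_pos_nonneg sum_nonneg) auto
  have small: "B n \<le> C * \<rho> ^ n" if "n < N + m" for n
  proof -
    have "\<bar>B n\<bar> / \<rho> ^ n \<le> (\<Sum>n<N + m. \<bar>B n\<bar> / \<rho> ^ n)"
      using that \<rho> by (intro member_le_sum) auto
    then have "\<bar>B n\<bar> / \<rho> ^ n \<le> C" by (simp add: C_def)
    then show ?thesis using \<rho>(1) by (simp add: divide_simps split: if_splits)
  qed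
  have "w n y \<le> C * \<rho> ^ n" if "poly (poly_iterate T n) y \<in> I" for n y
    using that
  proof (induction n arbitrary: y rule: less_induct)
    case (less n)
    show ?case
    proof (cases "n < N + m")
      case True
      then show ?thesis using B[OF less.prems] small[of n] by linarith
    next
      case False
      define k where "k = n - m"
      have n: "n = k + m" "k + m \<ge> N" "k < n" using False m(1) by (auto simp: k_def)
      have "poly (poly_iterate T k) (poly (poly_iterate T m) y) \<in> I"
        using less.prems n(1) by (simp add: poly_iterate_add poly_pcompose)
      from less.IH[OF n(3) this] have "w k (poly (poly_iterate T m) y) / 4 \<le> C * \<rho> ^ k / 4" by simp
      moreover have "w n y \<le> w k (poly (poly_iterate T m) y) / 4"
        using rec[OF n(2)] less.prems n(1) by simp
      moreover have "C * \<rho> ^ k / 4 = C * \<rho> ^ n" unfolding n(1) power_add \<rho>m by simp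
      ultimately show ?thesis by linarith
    qed
  qed
  then show ?thesis using that[OF \<rho> C] by (simp add: w_def)
qed


subsection \<open>Inverting the identity minus the Ruelle operator\<close>

text \<open>By \<open>L_Suc\<close> this is the \<open>n\<close>-th power of the Ruelle operator of \<open>T\<close>, written as one average over the
  fibre of \<open>T\<^sub>n\<close>, where its size can be read off.\<close>

abbreviation L :: "nat \<Rightarrow> (complex \<Rightarrow> complex) \<Rightarrow> complex \<Rightarrow> complex" where
  "L n \<equiv> ruelle2 (poly_iterate T n) I"

lemma L_Suc: "L (Suc n) g = ruelle2 T I (L n g)"
  unfolding poly_iterate_Suc
  by (rule ruelle2_pcompose) (use degree_pos degree_iterate_pos vimage in auto)

lemma ruelle2_identity: "x \<in> I \<Longrightarrow> ruelle2 [:0, 1:] I g x = g x"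
  by (simp add: ruelle2_def pderiv_pCons)

lemma ruelle2_diff: "x \<in> I \<Longrightarrow> ruelle2 T I (\<lambda>x. g x - h x) x = ruelle2 T I g x - ruelle2 T I h x"
  by (simp add: ruelle2_def diff_divide_distrib sum_subtractf right_diff_distrib)

lemma continuous_on_ruelle2:
  assumes "continuous_on (poly T -` I) g"
  shows "ruelle2 T I g \<in> continuous_functions I"
proof -
  have "continuous_on I (\<lambda>x. 1 / of_nat (degree T) * (\<Sum>y | poly T y = x. g y / (poly (pderiv T) y)\<^sup>2))"
    using deriv_nonzero
    by (intro continuous_on_mult_left continuous_on_fibre_sum degree_pos continuous_intros assms) auto
  then show ?thesis unfolding continuous_functions_def ruelle2_def by simp
qed

lemma L_continuous:
  assumes "g \<in> continuous_functions I" shows "continuous_on I (L n g)"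
proof (induction n)
  case 0
  have "continuous_on I (L 0 g) = continuous_on I g" by (intro continuous_on_cong refl) (simp add: ruelle2_identity)
  then show ?case using assms by (simp add: continuous_functions_def)
next
  case (Suc n)
  then have "continuous_on (poly T -` I) (L n g)" using vimage continuous_on_subset by blast
  then have "ruelle2 T I (L n g) \<in> continuous_functions I" by (rule continuous_on_ruelle2)
  then show ?case unfolding L_Suc by (simp add: continuous_functions_def)
qed

text \<open>The average over the \<open>d\<^sup>n\<close> points of a fibre of \<open>T\<^sub>n\<close> is bounded by its largest term.\<close>

lemma L_decay:
  assumes "g \<in> continuous_functions I"
  obtains \<rho> C :: real where "0 < \<rho>" "\<rho> < 1" "\<forall>n. \<forall>x\<in>I. norm (L n g x) \<le> C * \<rho> ^ n"
proof -
  have "compact (g ` I)"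
    using assms by (intro compact_continuous_image compact_interval) (simp add: continuous_functions_def)
  then obtain M where M: "\<And>y. y \<in> I \<Longrightarrow> norm (g y) \<le> M"
    using compact_imp_bounded[of "g ` I"] by (auto simp: bounded_iff)
  obtain \<rho> C :: real where C: "0 < \<rho>" "\<rho> < 1" "0 < C"
    "\<forall>n y. poly (poly_iterate T n) y \<in> I \<longrightarrow>
       norm (1 / (poly (pderiv (poly_iterate T n)) y)\<^sup>2) \<le> C * \<rho> ^ n"
    by (rule iterate_deriv_decay)
  show ?thesis
  proof (rule that[of \<rho> "M * C"], goal_cases)
    case 3
    show ?case
    proof (intro allI ballI)
      fix n x assume x: "x \<in> I"
      let ?S = "poly_iterate T n"
      have card: "card {y. poly ?S y = x} = degree ?S"
        using iterate_deriv x by (intro card_simple_fibre degree_iterate_pos) auto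
      have "norm (\<Sum>y | poly ?S y = x. g y / (poly (pderiv ?S) y)\<^sup>2)
          \<le> (\<Sum>y | poly ?S y = x. M * (C * \<rho> ^ n))"
      proof (rule sum_norm_le)
        fix y assume "y \<in> {y. poly ?S y = x}"
        then have y: "poly ?S y \<in> I" using x by simp
        have "norm (g y) \<le> M" using M iterate_vimage[OF y] by blast
        moreover have "norm (1 / (poly (pderiv ?S) y)\<^sup>2) \<le> C * \<rho> ^ n" using C(4) y by blast
        ultimately have "norm (g y) * norm (1 / (poly (pderiv ?S) y)\<^sup>2) \<le> M * (C * \<rho> ^ n)"
          using C(1,3) order_trans[OF norm_ge_zero \<open>norm (g y) \<le> M\<close>] by (intro mult_mono) auto
        then show "norm (g y / (poly (pderiv ?S) y)\<^sup>2) \<le> M * (C * \<rho> ^ n)"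
          by (simp add: norm_divide)
      qed
      then have "norm (\<Sum>y | poly ?S y = x. g y / (poly (pderiv ?S) y)\<^sup>2)
          \<le> of_nat (degree ?S) * (M * (C * \<rho> ^ n))" using card by simp
      then show "norm (L n g x) \<le> M * C * \<rho> ^ n"
        using x degree_iterate_pos[of n]
        by (simp add: ruelle2_def norm_divide divide_simps mult_ac)
    qed
  qed (use C in auto)
qed

text \<open>A solution of \<open>u = L\<^sub>2 u\<close> equals \<open>L\<^sub>2\<^sup>n u\<close> for all \<open>n\<close>, hence vanishes. A preimage of \<open>g\<close> is the Neumann
  series \<open>\<Sum>L\<^sub>2\<^sup>n g\<close>, which converges uniformly by \<open>L_decay\<close>; since \<open>L\<^sub>2\<close> is a finite sum in each point, it
  may be applied term by term.\<close>

lemma id_minus_ruelle2_bij: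
  "bij_betw (id_minus_ruelle2 T I) (continuous_functions I) (continuous_functions I)"
proof (rule bij_betw_imageI)
  let ?C = "continuous_functions I"
  have mem: "g \<in> ?C \<longleftrightarrow> g \<in> extensional I \<and> continuous_on I g" for g
    by (simp add: continuous_functions_def)
  have ruelle_C: "ruelle2 T I g \<in> ?C" if "g \<in> ?C" for g
    using that vimage by (intro continuous_on_ruelle2) (auto simp: mem intro: continuous_on_subset)
  show "inj_on (id_minus_ruelle2 T I) ?C"
  proof (rule inj_onI)
    fix g h assume gh: "g \<in> ?C" "h \<in> ?C" and eq: "id_minus_ruelle2 T I g = id_minus_ruelle2 T I h"
    define u where "u = (\<lambda>x\<in>I. g x - h x)"
    have u: "u \<in> ?C" using gh unfolding mem u_def by (auto intro!: continuous_intros)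
    have fixp: "ruelle2 T I u x = u x" if x: "x \<in> I" for x
    proof -
      have "ruelle2 T I u = ruelle2 T I (\<lambda>x. g x - h x)"
        using vimage by (intro ruelle2_cong) (auto simp: u_def)
      then have "ruelle2 T I u x = ruelle2 T I g x - ruelle2 T I h x" using ruelle2_diff[OF x] by simp
      moreover have "g x - ruelle2 T I g x = h x - ruelle2 T I h x"
        using fun_cong[OF eq, of x] x by (simp add: id_minus_ruelle2_def)
      moreover have "u x = g x - h x" using x by (simp add: u_def)
      ultimately show ?thesis by (simp add: diff_eq_eq)
    qed
    have iter: "L n u x = u x" if "x \<in> I" for n x
      using that
    proof (induction n arbitrary: x)
      case (Suc n)
      have "L (Suc n) u = ruelle2 T I u"
        unfolding L_Suc using vimage by (intro ruelle2_cong Suc.IH) auto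
      then show ?case using fixp Suc.prems by simp
    qed (simp add: ruelle2_identity)
    obtain \<rho> C :: real where C: "0 < \<rho>" "\<rho> < 1" "\<forall>n. \<forall>x\<in>I. norm (L n u x) \<le> C * \<rho> ^ n"
      by (rule L_decay[OF u])
    have "u x = 0" if x: "x \<in> I" for x
    proof -
      have "(\<lambda>n. C * \<rho> ^ n) \<longlonglongrightarrow> C * 0" using C by (intro tendsto_intros LIMSEQ_realpow_zero) auto
      then have "norm (u x) \<le> C * 0"
        by (rule tendsto_lowerbound[OF _ always_eventually]) (use C(3)[rule_format, OF x] iter[OF x] in auto)
      then show ?thesis by simp
    qed
    then show "g = h" using gh unfolding mem
      by (intro extensionalityI[of _ I]) (auto simp: u_def)
  qed
  show "id_minus_ruelle2 T I ` ?C = ?C"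
  proof (intro equalityI subsetI)
    fix g assume "g \<in> id_minus_ruelle2 T I ` ?C"
    then obtain h where h: "h \<in> ?C" "g = id_minus_ruelle2 T I h" by blast
    then show "g \<in> ?C" using ruelle_C[OF h(1)]
      unfolding mem h(2) id_minus_ruelle2_def by (auto intro!: continuous_intros)
  next
    fix g assume g: "g \<in> ?C"
    obtain \<rho> C :: real where C: "0 < \<rho>" "\<rho> < 1" "\<forall>n. \<forall>x\<in>I. norm (L n g x) \<le> C * \<rho> ^ n"
      by (rule L_decay[OF g])
    have sum: "summable (\<lambda>n. C * \<rho> ^ n)" using C by (intro summable_mult summable_geometric) auto
    define h where "h = (\<lambda>x\<in>I. \<Sum>n. L n g x)"
    have "uniform_limit I (\<lambda>n x. \<Sum>i<n. L i g x) (\<lambda>x. \<Sum>n. L n g x) sequentially"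
      by (rule Weierstrass_m_test[OF _ sum]) (rule C(3)[rule_format])
    then have "continuous_on I (\<lambda>x. \<Sum>n. L n g x)"
      by (rule uniform_limit_theorem[rotated])
         (auto intro!: always_eventually continuous_on_sum L_continuous g)
    then have h: "h \<in> ?C" by (simp add: mem h_def)
    have sums: "(\<lambda>n. L n g y) sums h y" if "y \<in> I" for y
    proof -
      have "summable (\<lambda>n. L n g y)" by (rule summable_comparison_test'[OF sum]) (rule C(3)[rule_format, OF that])
      then show ?thesis using that by (simp add: h_def summable_sums)
    qed
    have "id_minus_ruelle2 T I h x = g x" if x: "x \<in> I" for x
    proof -
      have "(\<lambda>n. 1 / of_nat (degree T) * (\<Sum>y | poly T y = x. L n g y / (poly (pderiv T) y)\<^sup>2))
        sums (1 / of_nat (degree T) * (\<Sum>y | poly T y = x. h y / (poly (pderiv T) y)\<^sup>2))"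
        using x vimage by (intro sums_mult sums_sum sums_divide sums) auto
      then have "(\<lambda>n. L (Suc n) g x) sums ruelle2 T I h x"
        unfolding L_Suc using x by (simp add: ruelle2_def)
      moreover have "(\<lambda>n. L (Suc n) g x) sums (h x - L 0 g x)"
        using sums[OF x] by (subst sums_Suc_iff) simp
      ultimately have "ruelle2 T I h x = h x - L 0 g x" by (rule sums_unique2)
      then have "ruelle2 T I h x = h x - g x" using x by (simp add: ruelle2_identity)
      then show ?thesis using x by (simp add: id_minus_ruelle2_def)
    qed
    moreover have "id_minus_ruelle2 T I h \<in> extensional I" by (simp add: id_minus_ruelle2_def)
    ultimately have "id_minus_ruelle2 T I h = g"
      using g unfolding mem by (intro extensionalityI[of _ I]) auto
    then show "g \<in> id_minus_ruelle2 T I ` ?C" using h by blast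
  qed
qed

lemma ruelle2_schwarzian_continuous: "ruelle2 T I (schwarzian T) \<in> continuous_functions I"
  unfolding schwarzian_def[abs_def]
  by (intro continuous_on_ruelle2 continuous_intros) (use deriv_nonzero in auto)

text \<open>With \<open>h\<close> the right-hand side, \<open>h - L\<^sub>2\<^sup>n (schwarzian T\<^sub>n) = L\<^sub>2\<^sup>n h\<close> by induction: both sides satisfy the same recursion,
  by the cocycle identity on the left, and agree for \<open>n = 0\<close>, where \<open>T\<^sub>0\<close> is the identity with vanishing
  Schwarzian.\<close>

lemma ruelle2_iterate_schwarzian_limit:
  assumes x: "x \<in> I"
  shows "(\<lambda>n. L n (schwarzian (poly_iterate T n)) x) \<longlonglongrightarrow>
    the_inv_into (continuous_functions I) (id_minus_ruelle2 T I) (ruelle2 T I (schwarzian T)) x"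
proof -
  let ?S = "\<lambda>n. schwarzian (poly_iterate T n)"
  define h where "h = the_inv_into (continuous_functions I) (id_minus_ruelle2 T I) (ruelle2 T I (schwarzian T))"
  note bij = id_minus_ruelle2_bij
  have h: "h \<in> continuous_functions I"
    unfolding h_def
    by (rule the_inv_into_into[OF bij_betw_imp_inj_on[OF bij]])
       (simp_all add: bij_betw_imp_surj_on[OF bij] ruelle2_schwarzian_continuous)
  have eq: "id_minus_ruelle2 T I h = ruelle2 T I (schwarzian T)"
    unfolding h_def by (rule f_the_inv_into_f_bij_betw[OF bij]) (simp add: ruelle2_schwarzian_continuous)
  have fix_h: "h z = ruelle2 T I (schwarzian T) z + ruelle2 T I h z" if "z \<in> I" for z
  proof -
    have "h z - ruelle2 T I h z = ruelle2 T I (schwarzian T) z"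
      using fun_cong[OF eq, of z] that by (simp add: id_minus_ruelle2_def)
    then show ?thesis by (simp add: diff_eq_eq)
  qed
  have diff: "h z - L n (?S n) z = L n h z" if "z \<in> I" for n z
    using that
  proof (induction n arbitrary: z)
    case 0
    then show ?case by (simp add: ruelle2_identity schwarzian_def pderiv_pCons)
  next
    case (Suc n)
    have "L (Suc n) (?S (Suc n)) z = ruelle2 T I (schwarzian T) z + ruelle2 T I (L n (?S n)) z"
      unfolding poly_iterate_Suc
    proof (rule ruelle2_schwarzian_pcompose[OF degree_pos degree_iterate_pos])
      show "y \<in> I" if "poly T y \<in> I" for y using that vimage by blast
      show "poly (pderiv (poly_iterate T n)) y \<noteq> 0" if "poly (poly_iterate T n) y \<in> I" for y
        using iterate_deriv[OF that] by simp
    qed (fact deriv_nonzero Suc.prems)+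
    then have "h z - L (Suc n) (?S (Suc n)) z = ruelle2 T I (\<lambda>z. h z - L n (?S n) z) z"
      using fix_h[OF Suc.prems] ruelle2_diff[OF Suc.prems] by simp
    also have "ruelle2 T I (\<lambda>z. h z - L n (?S n) z) = L (Suc n) h"
      unfolding L_Suc using vimage by (intro ruelle2_cong Suc.IH) blast
    finally show ?case .
  qed
  obtain \<rho> C :: real where C: "0 < \<rho>" "\<rho> < 1" "\<forall>n. \<forall>x\<in>I. norm (L n h x) \<le> C * \<rho> ^ n"
    by (rule L_decay[OF h])
  have "(\<lambda>n. C * \<rho> ^ n) \<longlonglongrightarrow> C * 0" using C by (intro tendsto_intros LIMSEQ_realpow_zero) auto
  then have lim0: "(\<lambda>n. C * \<rho> ^ n) \<longlonglongrightarrow> 0" by simp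
  have "(\<lambda>n. L n h x) \<longlonglongrightarrow> 0"
    using C(3) x by (intro Lim_null_comparison[OF always_eventually lim0]) simp
  from tendsto_diff[OF tendsto_const this, of "h x"]
  have "(\<lambda>n. h x - L n h x) \<longlonglongrightarrow> h x" by simp
  moreover have "h x - L n h x = L n (?S n) x" for n by (simp only: diff[OF x, symmetric]) simp
  ultimately show ?thesis by (simp add: h_def)
qed

end


section \<open>Polynomials of a matrix\<close>

lemma mult_mat_index:
  assumes "A \<in> carrier_mat n n" "B \<in> carrier_mat n n" "i < n" "j < n"
  shows "(A * B) $$ (i, j) = (\<Sum>k<n. A $$ (i, k) * B $$ (k, j))"
  using assms by (auto simp: scalar_prod_def lessThan_atLeast0 intro!: sum.cong)

lemma the_mat_inverse:
  fixes A B :: "complex mat"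
  assumes A: "A \<in> carrier_mat n n" and B: "B \<in> carrier_mat n n" and AB: "A * B = 1\<^sub>m n"
  shows "the (mat_inverse A) = B"
proof -
  have "A \<in> Units (ring_mat TYPE(complex) n ())"
    using A B AB mat_mult_left_right_inverse[OF A B AB] by (auto simp: Units_def ring_mat_simps)
  then obtain C where C: "mat_inverse A = Some C"
    using mat_inverse(1)[OF A, of "()"] by (cases "mat_inverse A") auto
  then have "C * A = 1\<^sub>m n" "C \<in> carrier_mat n n" using mat_inverse(2)[OF A C] by auto
  then have "C = C * (A * B)" using AB by simp
  also have "\<dots> = B" using \<open>C * A = 1\<^sub>m n\<close> \<open>C \<in> carrier_mat n n\<close> A B
    by (simp flip: assoc_mult_mat)
  finally show ?thesis using C by simp
qed

lemma pow_mat_Suc_left: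
  assumes A: "A \<in> carrier_mat n n"
  shows "A ^\<^sub>m Suc k = A * A ^\<^sub>m k"
proof (induction k)
  case 0 show ?case using A by simp
next
  case (Suc k)
  have "A ^\<^sub>m Suc (Suc k) = (A * A ^\<^sub>m k) * A" using Suc by simp
  also have "\<dots> = A * A ^\<^sub>m Suc k" using A by (simp add: assoc_mult_mat[OF A pow_carrier_mat[OF A] A])
  finally show ?case .
qed

lemma poly_mat_carrier [simp]: "A \<in> carrier_mat n n \<Longrightarrow> poly_mat p A \<in> carrier_mat n n"
  by (auto simp: poly_mat_def)

lemma poly_mat_index:
  assumes "A \<in> carrier_mat n n" "i < n" "j < n" "degree p \<le> N"
  shows "poly_mat p A $$ (i, j) = (\<Sum>k\<le>N. coeff p k * (A ^\<^sub>m k) $$ (i, j))"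
proof -
  have "poly_mat p A $$ (i, j) = (\<Sum>k\<le>degree p. coeff p k * (A ^\<^sub>m k) $$ (i, j))"
    using assms by (auto simp: poly_mat_def)
  also have "\<dots> = (\<Sum>k\<le>N. coeff p k * (A ^\<^sub>m k) $$ (i, j))"
    using assms(4) by (intro sum.mono_neutral_left) (auto simp: coeff_eq_0)
  finally show ?thesis .
qed

lemma poly_mat_0: "A \<in> carrier_mat n n \<Longrightarrow> poly_mat 0 A = 0\<^sub>m n n"
  by (auto simp: poly_mat_def)

lemma poly_mat_add:
  assumes "A \<in> carrier_mat n n"
  shows "poly_mat (p + q) A = poly_mat p A + poly_mat q A"
proof (rule eq_matI)
  let ?N = "max (degree p) (degree q)"
  fix i j assume "i < dim_row (poly_mat p A + poly_mat q A)" "j < dim_col (poly_mat p A + poly_mat q A)"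
  then have ij: "i < n" "j < n" using assms by (auto simp: poly_mat_def)
  have "poly_mat (p + q) A $$ (i, j) = (\<Sum>k\<le>?N. coeff (p + q) k * (A ^\<^sub>m k) $$ (i, j))"
    by (rule poly_mat_index[OF assms ij]) (rule degree_add_le_max)
  also have "\<dots> = poly_mat p A $$ (i, j) + poly_mat q A $$ (i, j)"
    by (simp add: poly_mat_index[OF assms ij, of _ ?N] distrib_right sum.distrib)
  finally show "poly_mat (p + q) A $$ (i, j) = (poly_mat p A + poly_mat q A) $$ (i, j)"
    using assms ij by (simp add: poly_mat_def)
qed (use assms in \<open>auto simp: poly_mat_def\<close>)

lemma poly_mat_smult:
  assumes "A \<in> carrier_mat n n"
  shows "poly_mat (Polynomial.smult c p) A = c \<cdot>\<^sub>m poly_mat p A"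
proof (rule eq_matI)
  fix i j assume "i < dim_row (c \<cdot>\<^sub>m poly_mat p A)" "j < dim_col (c \<cdot>\<^sub>m poly_mat p A)"
  then have ij: "i < n" "j < n" using assms by (auto simp: poly_mat_def)
  have "poly_mat (Polynomial.smult c p) A $$ (i, j)
      = (\<Sum>k\<le>degree p. coeff (Polynomial.smult c p) k * (A ^\<^sub>m k) $$ (i, j))"
    by (rule poly_mat_index[OF assms ij]) (rule degree_smult_le)
  also have "\<dots> = c * poly_mat p A $$ (i, j)"
    by (simp add: poly_mat_index[OF assms ij order_refl] sum_distrib_left mult.assoc)
  finally show "poly_mat (Polynomial.smult c p) A $$ (i, j) = (c \<cdot>\<^sub>m poly_mat p A) $$ (i, j)"
    using assms ij by (simp add: poly_mat_def)
qed (use assms in \<open>auto simp: poly_mat_def\<close>)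

text \<open>Horner's rule, from which multiplicativity follows by induction on the polynomial.\<close>

lemma poly_mat_pCons:
  assumes A: "A \<in> carrier_mat n n"
  shows "poly_mat (pCons a p) A = a \<cdot>\<^sub>m 1\<^sub>m n + A * poly_mat p A"
proof (rule eq_matI)
  fix i j assume "i < dim_row (a \<cdot>\<^sub>m 1\<^sub>m n + A * poly_mat p A)" "j < dim_col (a \<cdot>\<^sub>m 1\<^sub>m n + A * poly_mat p A)"
  then have ij: "i < n" "j < n" using A by (auto simp: poly_mat_def)
  have "poly_mat (pCons a p) A $$ (i, j)
      = (\<Sum>k\<le>Suc (degree p). coeff (pCons a p) k * (A ^\<^sub>m k) $$ (i, j))"
    by (rule poly_mat_index[OF A ij]) (rule degree_pCons_le)
  also have "\<dots> = a * (A ^\<^sub>m 0) $$ (i, j) + (\<Sum>k\<le>degree p. coeff p k * (A ^\<^sub>m Suc k) $$ (i, j))"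
    by (subst sum.atMost_Suc_shift) simp
  also have "(\<Sum>k\<le>degree p. coeff p k * (A ^\<^sub>m Suc k) $$ (i, j))
      = (\<Sum>k\<le>degree p. \<Sum>l<n. coeff p k * (A $$ (i, l) * (A ^\<^sub>m k) $$ (l, j)))"
    by (simp only: pow_mat_Suc_left[OF A] mult_mat_index[OF A pow_carrier_mat[OF A] ij] sum_distrib_left)
  also have "\<dots> = (\<Sum>l<n. A $$ (i, l) * poly_mat p A $$ (l, j))"
    by (subst sum.swap) (simp add: poly_mat_index[OF A _ ij(2) order_refl] sum_distrib_left mult_ac)
  also have "\<dots> = (A * poly_mat p A) $$ (i, j)"
    using mult_mat_index[OF A poly_mat_carrier[OF A] ij] by simp
  finally show "poly_mat (pCons a p) A $$ (i, j) = (a \<cdot>\<^sub>m 1\<^sub>m n + A * poly_mat p A) $$ (i, j)"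
    using A ij by (simp add: poly_mat_def)
qed (use A in \<open>auto simp: poly_mat_def\<close>)

lemma poly_mat_mult:
  assumes A: "A \<in> carrier_mat n n"
  shows "poly_mat (p * q) A = poly_mat p A * poly_mat q A"
proof (induction p)
  case 0
  show ?case using A by (simp add: poly_mat_0[OF A] left_mult_zero_mat[OF poly_mat_carrier[OF A]])
next
  case (pCons a p)
  let ?p = "poly_mat p A" and ?q = "poly_mat q A"
  have c: "?p \<in> carrier_mat n n" "?q \<in> carrier_mat n n" using A by auto
  have zero: "0 \<cdot>\<^sub>m 1\<^sub>m n + M = M" if "M \<in> carrier_mat n n" for M :: "complex mat"
    using that by (intro eq_matI) auto
  have "poly_mat (pCons a p * q) A = a \<cdot>\<^sub>m ?q + (0 \<cdot>\<^sub>m 1\<^sub>m n + A * (?p * ?q))"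
    by (simp add: poly_mat_add[OF A] poly_mat_smult[OF A] poly_mat_pCons[OF A] pCons.IH)
  also have "\<dots> = a \<cdot>\<^sub>m (1\<^sub>m n * ?q) + (A * ?p) * ?q"
    by (simp only: zero[OF mult_carrier_mat[OF A mult_carrier_mat[OF c]]]
        assoc_mult_mat[OF A c] left_mult_one_mat[OF c(2)])
  also have "a \<cdot>\<^sub>m (1\<^sub>m n * ?q) = (a \<cdot>\<^sub>m 1\<^sub>m n) * ?q"
    by (rule mult_smult_assoc_mat[OF one_carrier_mat c(2), symmetric])
  also have "(a \<cdot>\<^sub>m 1\<^sub>m n) * ?q + (A * ?p) * ?q = poly_mat (pCons a p) A * ?q"
    unfolding poly_mat_pCons[OF A] 
    by (rule add_mult_distrib_mat[symmetric, of _ n n _ _ n]) (use A c in auto)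
  finally show ?case .
qed

lemma pow_mat_symmetric:
  fixes A :: "complex mat"
  assumes A: "A \<in> carrier_mat n n" and sym: "\<And>i j. i < n \<Longrightarrow> j < n \<Longrightarrow> A $$ (i, j) = A $$ (j, i)"
  shows "i < n \<Longrightarrow> j < n \<Longrightarrow> (A ^\<^sub>m k) $$ (i, j) = (A ^\<^sub>m k) $$ (j, i)"
proof (induction k arbitrary: i j)
  case 0
  then show ?case using A by auto
next
  case (Suc k)
  have "(A ^\<^sub>m Suc k) $$ (i, j) = (\<Sum>l<n. A $$ (i, l) * (A ^\<^sub>m k) $$ (l, j))"
    unfolding pow_mat_Suc_left[OF A] using A Suc.prems by (intro mult_mat_index) auto
  also have "\<dots> = (\<Sum>l<n. (A ^\<^sub>m k) $$ (j, l) * A $$ (l, i))"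
  proof (intro sum.cong refl)
    fix l assume "l \<in> {..<n}"
    then have l: "l < n" by simp
    show "A $$ (i, l) * (A ^\<^sub>m k) $$ (l, j) = (A ^\<^sub>m k) $$ (j, l) * A $$ (l, i)"
      unfolding Suc.IH[OF l Suc.prems(2)] sym[OF Suc.prems(1) l] by (rule mult.commute)
  qed
  also have "\<dots> = (A ^\<^sub>m Suc k) $$ (j, i)"
    using A Suc.prems by (simp add: mult_mat_index[of _ n] del: index_mult_mat)
  finally show ?case .
qed

lemma poly_mat_symmetric:
  assumes A: "A \<in> carrier_mat n n" and sym: "\<And>i j. i < n \<Longrightarrow> j < n \<Longrightarrow> A $$ (i, j) = A $$ (j, i)"
    and ij: "i < n" "j < n"
  shows "poly_mat p A $$ (i, j) = poly_mat p A $$ (j, i)"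
  by (simp only: poly_mat_index[OF A ij order_refl] poly_mat_index[OF A ij(2,1) order_refl]
      pow_mat_symmetric[OF A sym ij])


section \<open>Orthonormal polynomials on a real simple fibre\<close>

text \<open>The trace formula for one polynomial and one value depends only on the fibre being real and simple
  and on the coefficients being real.\<close>

locale real_simple_fibre =
  fixes S :: "complex poly" and x :: complex
  assumes degree_pos: "degree S > 0"
    and real_coeffs: "real_coeffs S"
    and fibre_real: "\<And>y. poly S y = x \<Longrightarrow> y \<in> \<real>"
    and fibre_simple: "\<And>y. poly S y = x \<Longrightarrow> poly (pderiv S) y \<noteq> 0"
begin

abbreviation d :: nat where "d \<equiv> degree S"

abbreviation \<Lambda> :: "complex set" where "\<Lambda> \<equiv> {y. poly S y = x}"

abbreviation inner :: "complex poly \<Rightarrow> complex poly \<Rightarrow> complex" where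
  "inner \<equiv> root_inner S x"

lemma card_fibre: "card \<Lambda> = d" and finite_nodes: "finite \<Lambda>"
  using card_simple_fibre[OF degree_pos fibre_simple] degree_pos by (auto intro: card_ge_0_finite)

lemma inner_add: "inner (p + q) r = inner p r + inner q r"
  by (simp only: root_inner_def poly_add distrib_right sum.distrib distrib_left)

lemma inner_diff: "inner (p - q) r = inner p r - inner q r"
  by (simp only: root_inner_def poly_diff left_diff_distrib sum_subtractf right_diff_distrib)

lemma inner_smult: "inner (Polynomial.smult c p) r = c * inner p r"
  by (simp only: root_inner_def poly_smult mult.assoc sum_distrib_left[symmetric] mult.left_commute[of _ c])

lemma inner_0: "inner 0 r = 0"
  by (simp add: root_inner_def)

lemma inner_sum: "inner (\<Sum>k\<in>A. f k) r = (\<Sum>k\<in>A. inner (f k) r)"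
  by (induction A rule: infinite_finite_induct) (simp_all add: inner_0 inner_add)

lemma cnj_inner: "cnj (inner p q) = inner q p"
  by (simp add: root_inner_def mult.commute)

text \<open>A nonzero polynomial of degree below \<open>d\<close> cannot vanish at all \<open>d\<close> roots.\<close>

lemma inner_self_pos:
  assumes "degree p < d" "p \<noteq> 0"
  obtains r :: real where "r > 0" "inner p p = complex_of_real r"
proof -
  have "\<exists>y\<in>\<Lambda>. poly p y \<noteq> 0"
  proof (rule ccontr)
    assume "\<not> ?thesis"
    then have "p = 0" using assms(1) card_fibre by (intro poly_eqI_degree[of \<Lambda>]) auto
    then show False using assms(2) by simp
  qed
  then obtain y where y: "y \<in> \<Lambda>" "poly p y \<noteq> 0" by blast
  define r where "r = (1 / d) * (\<Sum>y\<in>\<Lambda>. (norm (poly p y))\<^sup>2)"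
  have "(\<Sum>y\<in>\<Lambda>. (norm (poly p y))\<^sup>2) > 0"
    by (rule sum_pos2[OF finite_nodes y(1)]) (use y(2) in auto)
  then have "r > 0" using degree_pos by (simp add: r_def)
  moreover have "inner p p = complex_of_real r"
    unfolding root_inner_def r_def
    by (simp only: of_real_mult of_real_sum complex_norm_square) simp
  ultimately show ?thesis using that by blast
qed

definition orthonormal :: "(nat \<Rightarrow> complex poly) \<Rightarrow> nat \<Rightarrow> bool" where
  "orthonormal P n \<longleftrightarrow> (\<forall>k<n. degree (P k) = k \<and> lead_coeff (P k) \<in> \<real> \<and> Re (lead_coeff (P k)) > 0 \<and>
     (\<forall>j<n. inner (P j) (P k) = (if j = k then 1 else 0)))"

text \<open>The Gram-Schmidt process, whose step \<open>n\<close> orthogonalises the monomial of degree \<open>n\<close>.\<close>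

lemma orthonormal_exists: "n \<le> d \<Longrightarrow> \<exists>P. orthonormal P n"
proof (induction n)
  case 0
  then show ?case by (simp add: orthonormal_def)
next
  case (Suc n)
  then obtain P where P: "orthonormal P n" by auto
  have degP: "degree (P k) = k" if "k < n" for k using P that by (auto simp: orthonormal_def)
  have orthP: "inner (P j) (P k) = (if j = k then 1 else 0)" if "j < n" "k < n" for j k
    using P that by (auto simp: orthonormal_def)
  define m where "m = Polynomial.monom (1::complex) n"
  define q where "q = m - (\<Sum>k<n. Polynomial.smult (inner m (P k)) (P k))"
  have cq: "coeff q i = (if i = n then 1 else 0)" if "i \<ge> n" for i
  proof -
    have "coeff (P k) i = 0" if "k < n" for k using that \<open>i \<ge> n\<close> degP by (intro coeff_eq_0) auto
    then show ?thesis by (simp add: q_def m_def coeff_sum)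
  qed
  have "degree q \<le> n" by (rule degree_le) (use cq in auto)
  moreover have "degree q \<ge> n" by (rule le_degree) (use cq[of n] in auto)
  ultimately have dq: "degree q = n" by simp
  have "q \<noteq> 0" using cq[of n] by auto
  then obtain r where r: "r > 0" "inner q q = complex_of_real r"
    using inner_self_pos[of q] dq Suc.prems by auto
  have qP: "inner q (P j) = 0" if "j < n" for j
  proof -
    have "inner q (P j) = inner m (P j) - (\<Sum>k<n. inner m (P k) * inner (P k) (P j))"
      by (simp add: q_def inner_diff inner_sum inner_smult)
    also have "(\<Sum>k<n. inner m (P k) * inner (P k) (P j)) = (\<Sum>k<n. if k = j then inner m (P k) else 0)"
      using that by (intro sum.cong) (auto simp: orthP)
    also have "\<dots> = inner m (P j)" using that by simp
    finally show ?thesis by simp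
  qed
  define e where "e = Polynomial.smult (complex_of_real (1 / sqrt r)) q"
  have "inner e e = complex_of_real (1 / sqrt r) * cnj (inner e q)"
    by (subst e_def) (simp only: inner_smult cnj_inner)
  also have "inner e q = complex_of_real (1 / sqrt r) * inner q q" by (simp only: e_def inner_smult)
  also have "complex_of_real (1 / sqrt r) * cnj (complex_of_real (1 / sqrt r) * inner q q)
      = complex_of_real ((1 / sqrt r) * (1 / sqrt r) * r)"
    by (simp only: r(2) complex_cnj_mult complex_cnj_complex_of_real of_real_mult mult.assoc)
  also have "(1 / sqrt r) * (1 / sqrt r) * r = 1" using r(1) by simp
  finally have ee: "inner e e = 1" by simp
  have eP: "inner e (P j) = 0" if "j < n" for j using qP[OF that] by (simp add: e_def inner_smult)
  then have Pe: "inner (P j) e = 0" if "j < n" for j using cnj_inner[of e "P j"] that by simp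
  have de: "degree e = n" using r(1) dq by (simp add: e_def)
  have "coeff e n = complex_of_real (1 / sqrt r)" using cq[of n] by (simp add: e_def)
  then have lc: "coeff e n \<in> \<real>" "Re (coeff e n) > 0"
    using r(1) by (simp_all del: of_real_divide)
  have "orthonormal (P(n := e)) (Suc n)"
    using P unfolding orthonormal_def by (auto simp: less_Suc_eq de lc ee eP Pe)
  then show ?case by blast
qed

lemma orthonormal_imp:
  assumes "orthonormal P n" "k < n"
  shows "degree (P k) = k" "lead_coeff (P k) \<in> \<real>" "Re (lead_coeff (P k)) > 0" "lead_coeff (P k) \<noteq> 0"
  using assms by (auto simp: orthonormal_def)

lemma orthonormal_inner:
  assumes "orthonormal P n" "j < n" "k < n"
  shows "inner (P j) (P k) = (if j = k then 1 else 0)"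
  using assms by (auto simp: orthonormal_def)

lemma inner_lower_degree:
  assumes P: "orthonormal P d" and n: "n < d"
  shows "k \<le> n \<Longrightarrow> (\<And>i. i \<ge> k \<Longrightarrow> coeff p i = 0) \<Longrightarrow> inner p (P n) = 0"
proof (induction k arbitrary: p)
  case 0
  then have "p = 0" by (intro poly_eqI) simp
  then show ?case by (simp add: inner_0)
next
  case (Suc k)
  let ?c = "coeff p k / lead_coeff (P k)"
  have k: "k < d" "k < n" using Suc.prems n by auto
  have lc: "lead_coeff (P k) \<noteq> 0" "degree (P k) = k" using orthonormal_imp[OF P k(1)] by auto
  have "inner (p - Polynomial.smult ?c (P k)) (P n) = 0"
  proof (rule Suc.IH)
    fix i assume "k \<le> i"
    then show "coeff (p - Polynomial.smult ?c (P k)) i = 0"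
      using Suc.prems(2)[of i] lc by (cases "i = k") (auto simp: coeff_eq_0)
  qed (use k in simp)
  then show ?case using orthonormal_inner[OF P k(1) n] k by (simp add: inner_diff inner_smult)
qed

text \<open>The polynomial \<open>P n\<close> is orthogonal to everything of lower degree, so only the top coefficient counts.
  Uniqueness, the band structure of the Jacobi matrix and its off-diagonal entries are all read off
  from this.\<close>

lemma inner_top_degree:
  assumes P: "orthonormal P d" and n: "n < d" and p: "degree p \<le> n"
  shows "inner p (P n) = coeff p n / lead_coeff (P n)"
proof -
  let ?c = "coeff p n / lead_coeff (P n)"
  have lc: "lead_coeff (P n) \<noteq> 0" "degree (P n) = n" using orthonormal_imp[OF P n] by auto
  have "inner (p - Polynomial.smult ?c (P n)) (P n) = 0"
  proof (rule inner_lower_degree[OF P n order_refl])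
    fix i assume "n \<le> i"
    then show "coeff (p - Polynomial.smult ?c (P n)) i = 0"
      using lc p by (cases "i = n") (auto simp: coeff_eq_0)
  qed
  then show ?thesis using orthonormal_inner[OF P n n] by (simp add: inner_diff inner_smult)
qed

text \<open>The two inner products of \<open>P k\<close> with \<open>Q k\<close> are the two quotients of the leading coefficients, which
  therefore agree. Then \<open>P k - Q k\<close> has lower degree and is orthogonal to itself.\<close>

lemma orthonormal_unique:
  assumes P: "orthonormal P d" and Q: "orthonormal Q d" and k: "k < d"
  shows "P k = Q k"
proof -
  have dP: "degree (P k) = k" and dQ: "degree (Q k) = k"
    using orthonormal_imp(1)[OF P k] orthonormal_imp(1)[OF Q k] by auto
  obtain a b where a: "lead_coeff (P k) = complex_of_real a" "a > 0"
    and b: "lead_coeff (Q k) = complex_of_real b" "b > 0"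
    using orthonormal_imp(2,3)[OF P k] orthonormal_imp(2,3)[OF Q k] by (auto elim!: Reals_cases)
  have "inner (Q k) (P k) = complex_of_real (b / a)"
    using inner_top_degree[OF P k, of "Q k"] dP dQ a b by simp
  moreover have "inner (P k) (Q k) = complex_of_real (a / b)"
    using inner_top_degree[OF Q k, of "P k"] dP dQ a b by simp
  ultimately have "complex_of_real (b / a) = complex_of_real (a / b)"
    using cnj_inner[of "P k" "Q k"] by simp
  then have "b / a = a / b" by (simp only: of_real_eq_iff)
  then have "a\<^sup>2 = b\<^sup>2" using a b by (simp add: field_simps power2_eq_square)
  then have ab: "a = b" using a b by simp
  show ?thesis
  proof (rule ccontr)
    let ?s = "P k - Q k"
    assume "P k \<noteq> Q k"
    then have "?s \<noteq> 0" by simp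
    moreover have "degree ?s \<le> k" using dP dQ by (intro degree_diff_le) auto
    ultimately obtain r where r: "r > 0" "inner ?s ?s = complex_of_real r"
      using inner_self_pos[of ?s] k by auto
    have "coeff ?s k = 0" using a b ab dP dQ by simp
    then have "inner ?s (P k) = 0" "inner ?s (Q k) = 0"
      using inner_top_degree[OF P k \<open>degree ?s \<le> k\<close>] inner_top_degree[OF Q k \<open>degree ?s \<le> k\<close>] by auto
    then have "inner (P k) ?s = 0" "inner (Q k) ?s = 0"
      using cnj_inner[of ?s "P k"] cnj_inner[of ?s "Q k"] by auto
    then have "inner ?s ?s = 0" by (simp add: inner_diff)
    then show False using r by simp
  qed
qed

text \<open>Orthonormality exhibits a right inverse of the square matrix of the values of \<open>P 0, ..., P (d - 1)\<close> on
  the fibre. It is also a left inverse, which is the completeness relation.\<close>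

lemma orthonormal_complete:
  assumes P: "orthonormal P d" and ab: "a \<in> \<Lambda>" "b \<in> \<Lambda>"
  shows "(\<Sum>k<d. poly (P k) a * cnj (poly (P k) b)) = (if a = b then of_nat d else 0)"
proof -
  obtain r where "bij_betw r {0..<card \<Lambda>} \<Lambda>" using ex_bij_betw_nat_finite[OF finite_nodes] by blast
  then have r: "bij_betw r {..<d} \<Lambda>" unfolding card_fibre atLeast0LessThan .
  define A where "A = mat d d (\<lambda>(i, j). poly (P i) (r j))"
  define B where "B = mat d d (\<lambda>(i, j). cnj (poly (P j) (r i)) / of_nat d)"
  have A: "A \<in> carrier_mat d d" and B: "B \<in> carrier_mat d d" by (auto simp: A_def B_def)
  have "A * B = 1\<^sub>m d"
  proof (rule eq_matI)
    fix i j assume "i < dim_row (1\<^sub>m d)" "j < dim_col (1\<^sub>m d :: complex mat)"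
    then have ij: "i < d" "j < d" by auto
    have "(A * B) $$ (i, j) = (\<Sum>k<d. poly (P i) (r k) * cnj (poly (P j) (r k)) / of_nat d)"
      unfolding mult_mat_index[OF A B ij] using ij by (intro sum.cong) (auto simp: A_def B_def)
    also have "\<dots> = (\<Sum>y\<in>\<Lambda>. poly (P i) y * cnj (poly (P j) y) / of_nat d)"
      by (rule sum.reindex_bij_betw[OF r])
    also have "\<dots> = inner (P i) (P j)" by (simp add: root_inner_def sum_divide_distrib)
    finally show "(A * B) $$ (i, j) = 1\<^sub>m d $$ (i, j)" using ij orthonormal_inner[OF P ij] by simp
  qed (auto simp: A_def B_def)
  then have BA: "B * A = 1\<^sub>m d" by (rule mat_mult_left_right_inverse[OF A B])
  have "a \<in> r ` {..<d}" "b \<in> r ` {..<d}" using r ab by (auto simp: bij_betw_def)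
  then obtain i j where ij: "i < d" "j < d" "a = r i" "b = r j" by auto
  have "(B * A) $$ (j, i) = (\<Sum>k<d. poly (P k) a * cnj (poly (P k) b)) / of_nat d"
    unfolding mult_mat_index[OF B A ij(2,1)] sum_divide_distrib
    using ij by (intro sum.cong) (auto simp: A_def B_def)
  moreover have "j = i \<longleftrightarrow> a = b" using r ij by (auto simp: bij_betw_def inj_on_def)
  ultimately have "(\<Sum>k<d. poly (P k) a * cnj (poly (P k) b)) / of_nat d = (if a = b then 1 else 0)"
    using ij(1,2) unfolding BA by simp
  then show ?thesis using degree_pos by (cases "a = b") (simp_all add: divide_eq_eq)
qed


text \<open>Parseval's identity in bilinear form.\<close>

lemma sum_complete:
  assumes P: "orthonormal P d"
  shows "(\<Sum>k<d. (\<Sum>a\<in>\<Lambda>. u a * poly (P k) a) * (\<Sum>b\<in>\<Lambda>. v b * cnj (poly (P k) b)))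
    = of_nat d * (\<Sum>a\<in>\<Lambda>. u a * v a)"
proof -
  have "(\<Sum>k<d. (\<Sum>a\<in>\<Lambda>. u a * poly (P k) a) * (\<Sum>b\<in>\<Lambda>. v b * cnj (poly (P k) b)))
      = (\<Sum>k<d. \<Sum>a\<in>\<Lambda>. \<Sum>b\<in>\<Lambda>. u a * v b * (poly (P k) a * cnj (poly (P k) b)))"
    unfolding sum_product by (simp only: mult_ac)
  also have "\<dots> = (\<Sum>a\<in>\<Lambda>. \<Sum>k<d. \<Sum>b\<in>\<Lambda>. u a * v b * (poly (P k) a * cnj (poly (P k) b)))"
    by (rule sum.swap)
  also have "\<dots> = (\<Sum>a\<in>\<Lambda>. \<Sum>b\<in>\<Lambda>. \<Sum>k<d. u a * v b * (poly (P k) a * cnj (poly (P k) b)))"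
    by (intro sum.cong refl sum.swap)
  also have "\<dots> = (\<Sum>a\<in>\<Lambda>. \<Sum>b\<in>\<Lambda>. if a = b then of_nat d * (u a * v a) else 0)"
  proof (intro sum.cong refl)
    fix a b assume "a \<in> \<Lambda>" "b \<in> \<Lambda>"
    from orthonormal_complete[OF P this]
    show "(\<Sum>k<d. u a * v b * (poly (P k) a * cnj (poly (P k) b)))
        = (if a = b then of_nat d * (u a * v a) else 0)"
      unfolding sum_distrib_left[symmetric] by simp
  qed
  also have "\<dots> = of_nat d * (\<Sum>a\<in>\<Lambda>. u a * v a)"
    using finite_nodes by (simp add: sum_distrib_left)
  finally show ?thesis .
qed

text \<open>Multiplication by \<open>f\<close> on functions on the fibre, in the orthonormal basis \<open>P 0, ..., P (d - 1)\<close>. It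
  diagonalises all matrices below, so that products, powers and inverses are computed pointwise on
  the fibre.\<close>

definition fmat :: "(nat \<Rightarrow> complex poly) \<Rightarrow> (complex \<Rightarrow> complex) \<Rightarrow> complex mat" where
  "fmat P f = mat d d (\<lambda>(i, j). 1 / of_nat d * (\<Sum>y\<in>\<Lambda>. f y * poly (P j) y * cnj (poly (P i) y)))"

lemma fmat_carrier [simp]: "fmat P f \<in> carrier_mat d d"
  by (simp add: fmat_def)

lemma fmat_index: "i < d \<Longrightarrow> j < d \<Longrightarrow>
    fmat P f $$ (i, j) = 1 / of_nat d * (\<Sum>y\<in>\<Lambda>. f y * poly (P j) y * cnj (poly (P i) y))"
  by (simp add: fmat_def)

lemma fmat_cong: "(\<And>y. y \<in> \<Lambda> \<Longrightarrow> f y = g y) \<Longrightarrow> fmat P f = fmat P g"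
  unfolding fmat_def by (intro cong_mat refl) (auto intro!: sum.cong)

lemma fmat_one: "orthonormal P d \<Longrightarrow> fmat P (\<lambda>_. 1) = 1\<^sub>m d"
proof (rule eq_matI)
  fix i j assume P: "orthonormal P d" and "i < dim_row (1\<^sub>m d)" "j < dim_col (1\<^sub>m d :: complex mat)"
  then have ij: "i < d" "j < d" by auto
  have "fmat P (\<lambda>_. 1) $$ (i, j) = inner (P j) (P i)"
    unfolding fmat_index[OF ij] root_inner_def by (simp only: mult_1)
  then show "fmat P (\<lambda>_. 1) $$ (i, j) = 1\<^sub>m d $$ (i, j)"
    using ij orthonormal_inner[OF P ij(2,1)] by simp
qed (auto simp: fmat_def)

lemma fmat_mult:
  assumes P: "orthonormal P d"
  shows "fmat P f * fmat P g = fmat P (\<lambda>y. f y * g y)"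
proof (rule eq_matI)
  fix i j assume "i < dim_row (fmat P (\<lambda>y. f y * g y))" "j < dim_col (fmat P (\<lambda>y. f y * g y))"
  then have ij: "i < d" "j < d" by (auto simp: fmat_def)
  let ?u = "\<lambda>a. f a * cnj (poly (P i) a)" and ?v = "\<lambda>b. g b * poly (P j) b"
  have "(fmat P f * fmat P g) $$ (i, j)
      = (\<Sum>k<d. (1 / of_nat d * (\<Sum>a\<in>\<Lambda>. ?u a * poly (P k) a)) * (1 / of_nat d * (\<Sum>b\<in>\<Lambda>. ?v b * cnj (poly (P k) b))))"
    unfolding mult_mat_index[OF fmat_carrier fmat_carrier ij]
    by (intro sum.cong refl) (simp add: fmat_index ij mult_ac)
  also have "\<dots> = 1 / of_nat d * (1 / of_nat d) *
      (\<Sum>k<d. (\<Sum>a\<in>\<Lambda>. ?u a * poly (P k) a) * (\<Sum>b\<in>\<Lambda>. ?v b * cnj (poly (P k) b)))"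
    by (simp only: sum_distrib_left mult_ac)
  also have "\<dots> = 1 / of_nat d * (\<Sum>a\<in>\<Lambda>. ?u a * ?v a)"
    unfolding sum_complete[OF P] using degree_pos by simp
  also have "\<dots> = fmat P (\<lambda>y. f y * g y) $$ (i, j)"
    unfolding fmat_index[OF ij] by (simp only: mult_ac)
  finally show "(fmat P f * fmat P g) $$ (i, j) = fmat P (\<lambda>y. f y * g y) $$ (i, j)" .
qed (auto simp: fmat_def)

lemma fmat_inverse:
  assumes P: "orthonormal P d" and f: "\<And>y. y \<in> \<Lambda> \<Longrightarrow> f y \<noteq> 0"
  shows "the (mat_inverse (fmat P f)) = fmat P (\<lambda>y. 1 / f y)"
proof (rule the_mat_inverse[OF fmat_carrier fmat_carrier])
  have "fmat P f * fmat P (\<lambda>y. 1 / f y) = fmat P (\<lambda>y. f y * (1 / f y))" by (rule fmat_mult[OF P])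
  also have "\<dots> = fmat P (\<lambda>_. 1)" by (rule fmat_cong) (use f in simp)
  finally show "fmat P f * fmat P (\<lambda>y. 1 / f y) = 1\<^sub>m d" by (simp only: fmat_one[OF P])
qed

abbreviation jac :: "(nat \<Rightarrow> complex poly) \<Rightarrow> complex mat" where
  "jac P \<equiv> fmat P (\<lambda>y. y)"

lemma jac_pow: "orthonormal P d \<Longrightarrow> jac P ^\<^sub>m k = fmat P (\<lambda>y. y ^ k)"
proof (induction k)
  case 0
  then show ?case by (simp add: fmat_one) (simp add: fmat_def)
next
  case (Suc k)
  have "jac P ^\<^sub>m Suc k = fmat P (\<lambda>y. y ^ k) * jac P" using Suc by simp
  also have "\<dots> = fmat P (\<lambda>y. y ^ k * y)" by (rule fmat_mult[OF Suc.prems])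
  finally show ?case by (simp add: mult.commute)
qed

lemma poly_mat_jac:
  assumes P: "orthonormal P d"
  shows "poly_mat p (jac P) = fmat P (poly p)"
proof (rule eq_matI)
  fix i j assume "i < dim_row (fmat P (poly p))" "j < dim_col (fmat P (poly p))"
  then have ij: "i < d" "j < d" by (auto simp: fmat_def)
  have "poly_mat p (jac P) $$ (i, j) = (\<Sum>k\<le>degree p. coeff p k * fmat P (\<lambda>y. y ^ k) $$ (i, j))"
    by (simp only: poly_mat_index[OF fmat_carrier ij order_refl] jac_pow[OF P])
  also have "\<dots> = (\<Sum>k\<le>degree p. \<Sum>y\<in>\<Lambda>. 1 / of_nat d * (coeff p k * y ^ k * poly (P j) y * cnj (poly (P i) y)))"
    by (simp only: fmat_index[OF ij] sum_distrib_left mult_ac)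
  also have "\<dots> = (\<Sum>y\<in>\<Lambda>. \<Sum>k\<le>degree p. 1 / of_nat d * (coeff p k * y ^ k * poly (P j) y * cnj (poly (P i) y)))"
    by (rule sum.swap)
  also have "\<dots> = fmat P (poly p) $$ (i, j)"
    unfolding fmat_index[OF ij] poly_altdef[of p] sum_distrib_left sum_distrib_right by (simp only: mult_ac)
  finally show "poly_mat p (jac P) $$ (i, j) = fmat P (poly p) $$ (i, j)" .
qed (auto simp: fmat_def poly_mat_def)

lemma jac_index:
  assumes "i < d" "j < d"
  shows "jac P $$ (i, j) = inner (pCons 0 (P j)) (P i)"
  unfolding fmat_index[OF assms] root_inner_def by simp

text \<open>The entries are \<open>\<langle>y P\<^sub>j, P\<^sub>i\<rangle>\<close>. As \<open>y P\<^sub>j\<close> has degree \<open>j + 1\<close>, those with \<open>i > j + 1\<close> vanish and those with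
  \<open>i = j + 1\<close> are quotients of leading coefficients. Multiplication by a real function is Hermitian,
  which gives the upper triangle and real diagonal entries.\<close>

lemma jacobi_matrix_jac:
  assumes P: "orthonormal P d"
  shows "jacobi_matrix d (jac P)"
proof -
  have herm: "cnj (jac P $$ (i, j)) = jac P $$ (j, i)" if "i < d" "j < d" for i j
  proof -
    have "cnj (jac P $$ (i, j)) = 1 / of_nat d * (\<Sum>y\<in>\<Lambda>. cnj y * cnj (poly (P j) y) * poly (P i) y)"
      by (simp add: fmat_index that)
    also have "\<dots> = 1 / of_nat d * (\<Sum>y\<in>\<Lambda>. y * poly (P i) y * cnj (poly (P j) y))"
    proof -
      have "cnj y = y" if "y \<in> \<Lambda>" for y using fibre_real that by (simp add: Reals_cnj_iff)
      then have "(\<Sum>y\<in>\<Lambda>. cnj y * cnj (poly (P j) y) * poly (P i) y)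
          = (\<Sum>y\<in>\<Lambda>. y * poly (P i) y * cnj (poly (P j) y))"
        by (intro sum.cong refl) (simp only: mult_ac)
      then show ?thesis by (simp only:)
    qed
    finally show ?thesis using that by (simp add: fmat_index)
  qed
  have low: "jac P $$ (i, j) = 0" if "j + 1 < i" "i < d" for i j
  proof -
    have j: "degree (P j) = j" using orthonormal_imp(1)[OF P] that by simp
    then have "degree (pCons 0 (P j)) < i" using that degree_pCons_le[of 0 "P j"] by linarith
    then have "inner (pCons 0 (P j)) (P i) = 0"
      using inner_top_degree[OF P that(2), of "pCons 0 (P j)"] by (simp add: coeff_eq_0)
    then show ?thesis using that by (simp add: jac_index)
  qed
  have sub: "\<exists>r>0. jac P $$ (j + 1, j) = complex_of_real r" if jd: "j + 1 < d" for j
  proof -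
    have j: "j < d" using jd by simp
    obtain a b where a: "lead_coeff (P j) = complex_of_real a" "a > 0"
      and b: "lead_coeff (P (j + 1)) = complex_of_real b" "b > 0"
      using orthonormal_imp(2,3)[OF P j] orthonormal_imp(2,3)[OF P jd] by (auto elim!: Reals_cases)
    have dj: "degree (P j) = j" using orthonormal_imp(1)[OF P j] .
    have "degree (pCons 0 (P j)) \<le> j + 1" using dj degree_pCons_le[of 0 "P j"] by simp
    from inner_top_degree[OF P jd this]
    have "jac P $$ (j + 1, j) = complex_of_real (a / b)"
      unfolding jac_index[OF jd j] using a b dj by simp
    then show ?thesis using a b by (intro exI[of _ "a / b"]) auto
  qed
  have real: "jac P $$ (i, j) \<in> \<real>" if ij: "i < d" "j < d" for i j
  proof -
    consider "i + 1 < j" | "j = i + 1" | "i = j" | "i = j + 1" | "j + 1 < i" by linarith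
    then show ?thesis
    proof cases
      case 1
      then show ?thesis using low[OF 1 that(2)] herm[OF that(2,1)] by simp
    next
      case 2
      then obtain r where "jac P $$ (j, i) = complex_of_real r" using sub[of i] ij by auto
      then show ?thesis using herm[OF that(2,1)] by (metis Reals_of_real complex_cnj_complex_of_real)
    next
      case 3
      then show ?thesis using herm[OF that] by (simp add: Reals_cnj_iff)
    next
      case 4
      then obtain r where "jac P $$ (i, j) = complex_of_real r" using sub[of j] ij by auto
      then show ?thesis by simp
    next
      case 5
      then show ?thesis using low[OF 5 that(1)] by simp
    qed
  qed
  have sym: "jac P $$ (i, j) = jac P $$ (j, i)" if "i < d" "j < d" for i j
    using herm[OF that] real[OF that] by (simp add: Reals_cnj_iff)
  show ?thesis unfolding jacobi_matrix_def
  proof (intro conjI allI impI)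
    fix i j assume "i < d" "j < d" "i + 1 < j"
    then show "jac P $$ (i, j) = 0" using sym[of i j] low[of i j] by simp
  next
    fix i assume i: "i + 1 < d"
    then show "0 < Re (jac P $$ (i, i + 1))" using sym[of i "i + 1"] sub[OF i] by auto
  qed (auto simp: real sym)
qed

lemma orthonormal_0:
  assumes P: "orthonormal P d"
  shows "P 0 = 1"
proof -
  have "degree (P 0) = 0" using orthonormal_imp(1)[OF P degree_pos] .
  then obtain c where c: "P 0 = [:c:]" by (rule degree_eq_zeroE)
  have "c \<in> \<real>" "Re c > 0" using orthonormal_imp(2,3)[OF P degree_pos] by (simp_all add: c)
  then obtain r where r: "c = complex_of_real r" "r > 0" by (auto elim!: Reals_cases)
  have "inner (P 0) (P 0) = complex_of_real (r * r)"
    using degree_pos by (simp add: root_inner_def c r card_fibre)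
  then have "complex_of_real (r * r) = 1" using orthonormal_inner[OF P degree_pos degree_pos] by simp
  then have "r * r = 1" by (simp only: of_real_eq_1_iff)
  then have "r = 1" using r(2) by (metis abs_of_pos real_sqrt_abs2 real_sqrt_one)
  then show ?thesis by (simp add: c r one_pCons)
qed

lemma fibre_log_derivative:
  assumes z: "z \<notin> \<Lambda>"
  shows "(poly (pderiv S) z / of_nat d) / (poly S z - x) = 1 / of_nat d * (\<Sum>y\<in>\<Lambda>. 1 / (z - y))"
proof -
  let ?P = "\<Prod>y\<in>\<Lambda>. [:-y, 1:]"
  have S: "S - [:x:] = Polynomial.smult (lead_coeff S) ?P"
    by (rule card_simple_fibre(2)[OF degree_pos fibre_simple])
  have "pderiv S = pderiv (S - [:x:])" by (simp add: pderiv_diff pderiv_pCons)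
  then have S': "pderiv S = Polynomial.smult (lead_coeff S) (pderiv ?P)" unfolding S by (simp only: pderiv_smult)
  have "poly (S - [:x:]) z = lead_coeff S * poly ?P z" unfolding S by (rule poly_smult)
  then have Sz: "poly S z - x = lead_coeff S * poly ?P z" by simp
  have "poly (pderiv ?P) z = poly ?P z * (\<Sum>y\<in>\<Lambda>. 1 / (z - y))"
    using pderiv_prod_linear(1)[of z "mset_set \<Lambda>"] z finite_nodes
    by (simp only: prod_unfold_prod_mset sum_unfold_sum_mset finite_set_mset_mset_set simp_thms)
  then have "poly (pderiv S) z = (poly S z - x) * (\<Sum>y\<in>\<Lambda>. 1 / (z - y))"
    unfolding S' Sz by simp
  moreover have "poly S z - x \<noteq> 0" using z by simp
  ultimately show ?thesis by simp
qed

lemma jac_resolvent: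
  assumes P: "orthonormal P d" and z: "z \<notin> \<Lambda>"
  shows "the (mat_inverse (z \<cdot>\<^sub>m 1\<^sub>m d - jac P)) $$ (0, 0)
    = (poly (pderiv S) z / of_nat d) / (poly S z - x)"
proof -
  have "z \<cdot>\<^sub>m 1\<^sub>m d - jac P = fmat P (\<lambda>y. z - y)"
  proof (rule eq_matI)
    fix i j assume "i < dim_row (fmat P (\<lambda>y. z - y))" "j < dim_col (fmat P (\<lambda>y. z - y))"
    then have ij: "i < d" "j < d" by (auto simp: fmat_def)
    have "(z \<cdot>\<^sub>m 1\<^sub>m d - jac P) $$ (i, j) = z * fmat P (\<lambda>_. 1) $$ (i, j) - jac P $$ (i, j)"
      unfolding fmat_one[OF P] using ij by (simp add: fmat_def)
    also have "\<dots> = fmat P (\<lambda>y. z - y) $$ (i, j)"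
      unfolding fmat_index[OF ij]
      by (simp only: left_diff_distrib sum_subtractf right_diff_distrib sum_distrib_left mult_1 mult_ac)
    finally show "(z \<cdot>\<^sub>m 1\<^sub>m d - jac P) $$ (i, j) = fmat P (\<lambda>y. z - y) $$ (i, j)" .
  qed (auto simp: fmat_def)
  moreover have "the (mat_inverse (fmat P (\<lambda>y. z - y))) = fmat P (\<lambda>y. 1 / (z - y))"
    by (rule fmat_inverse[OF P]) (use z in auto)
  ultimately show ?thesis
    unfolding fibre_log_derivative[OF z] by (simp add: fmat_index degree_pos orthonormal_0[OF P])
qed

end


section \<open>The resolvent determines the Jacobi matrix\<close>

lemma eventually_of_nat_notin_finite:
  fixes A :: "complex set"
  assumes "finite A"
  shows "eventually (\<lambda>n::nat. of_nat n \<notin> A) sequentially"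
proof -
  have "finite (of_nat -` A :: nat set)"
    using assms by (rule finite_vimageI) (simp add: inj_on_def)
  then show ?thesis
    unfolding cofinite_eq_sequentially[symmetric] eventually_cofinite by (simp add: vimage_def)
qed

lemma eventually_invertible_mat:
  fixes A :: "complex mat"
  assumes A: "A \<in> carrier_mat n n"
  shows "eventually (\<lambda>k::nat. invertible_mat (of_nat k \<cdot>\<^sub>m 1\<^sub>m n - A)) sequentially"
proof -
  have "char_poly A \<noteq> 0" using degree_monic_char_poly[OF A] by auto
  then have "finite {z. poly (char_poly A) z = 0}" by (rule poly_roots_finite)
  from eventually_of_nat_notin_finite[OF this] show ?thesis
  proof (rule eventually_mono)
    fix k :: nat assume k: "of_nat k \<notin> {z. poly (char_poly A) z = 0}"
    let ?M = "of_nat k \<cdot>\<^sub>m 1\<^sub>m n - A"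
    have M: "?M \<in> carrier_mat n n" by (rule minus_carrier_mat[OF A])
    have "- char_matrix A (of_nat k) = ?M"
      by (rule eq_matI) (use A in \<open>auto simp: char_matrix_def\<close>)
    then have "det ?M \<noteq> 0" using k char_poly_matrix[OF A, of "of_nat k"] by simp
    from det_non_zero_imp_unit[OF M this, of "()"]
    obtain B where "B \<in> carrier_mat n n" "B * ?M = 1\<^sub>m n" "?M * B = 1\<^sub>m n"
      by (auto simp: Units_def ring_mat_simps)
    then show "invertible_mat ?M"
      using M A unfolding invertible_mat_def inverts_mat_def by (auto intro!: exI[of _ B])
  qed
qed

lemma the_mat_inverse_left:
  fixes A :: "complex mat"
  assumes A: "A \<in> carrier_mat n n" and inv: "invertible_mat A"
  shows "the (mat_inverse A) \<in> carrier_mat n n" "the (mat_inverse A) * A = 1\<^sub>m n"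
proof -
  obtain B where B: "A * B = 1\<^sub>m n" "B * A = 1\<^sub>m (dim_row B)"
    using inv A unfolding invertible_mat_def inverts_mat_def by auto
  have "dim_row B = n" "dim_col B = n"
    using A arg_cong[OF B(1), of dim_col] arg_cong[OF B(2), of dim_col] by auto
  then have Bc: "B \<in> carrier_mat n n" by auto
  have "the (mat_inverse A) = B" by (rule the_mat_inverse[OF A Bc B(1)])
  then show "the (mat_inverse A) \<in> carrier_mat n n" "the (mat_inverse A) * A = 1\<^sub>m n"
    using Bc B(2) by auto
qed

text \<open>The resolvent \<open>R\<close> of \<open>A\<close> satisfies \<open>z R = 1 + R A\<close>. Comparing the sums of the moduli of the entries in
  row \<open>0\<close> bounds that row by \<open>2/|z|\<close> once \<open>|z|\<close> exceeds twice the size of \<open>A\<close>. It is enough to let \<open>z\<close> run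
  through the natural numbers \<open>k\<close>.\<close>

lemma resolvent_row_tendsto_0:
  fixes A :: "complex mat"
  assumes A: "A \<in> carrier_mat n n" and n: "n > 0"
  defines "R \<equiv> \<lambda>k::nat. the (mat_inverse (of_nat k \<cdot>\<^sub>m 1\<^sub>m n - A))"
  shows "eventually (\<lambda>k. \<forall>j<n. of_nat k * R k $$ (0, j)
      = (if j = 0 then 1 else 0) + (\<Sum>l<n. R k $$ (0, l) * A $$ (l, j))) sequentially"
    and "l < n \<Longrightarrow> (\<lambda>k. R k $$ (0, l)) \<longlonglongrightarrow> 0"
proof -
  let ?eq = "\<lambda>k. \<forall>j<n. of_nat k * R k $$ (0, j)
      = (if j = 0 then 1 else 0) + (\<Sum>l<n. R k $$ (0, l) * A $$ (l, j))"
  show ev: "eventually ?eq sequentially"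
    using eventually_invertible_mat[OF A]
  proof (rule eventually_mono, intro allI impI)
    fix k :: nat and j assume inv: "invertible_mat (of_nat k \<cdot>\<^sub>m 1\<^sub>m n - A)" and j: "j < n"
    let ?M = "of_nat k \<cdot>\<^sub>m 1\<^sub>m n - A"
    have M: "?M \<in> carrier_mat n n" by (rule minus_carrier_mat[OF A])
    have Rc: "R k \<in> carrier_mat n n" and RM: "R k * ?M = 1\<^sub>m n"
      using the_mat_inverse_left[OF M inv] by (auto simp: R_def)
    have "(if j = 0 then 1 else 0) = (R k * ?M) $$ (0, j)" unfolding RM using j n by auto
    also have "\<dots> = (\<Sum>l<n. R k $$ (0, l) * ((if l = j then of_nat k else 0) - A $$ (l, j)))"
      unfolding mult_mat_index[OF Rc M n j] using A j by (intro sum.cong) auto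
    also have "\<dots> = (\<Sum>l<n. if l = j then of_nat k * R k $$ (0, j) else 0)
        - (\<Sum>l<n. R k $$ (0, l) * A $$ (l, j))"
      unfolding sum_subtractf[symmetric] by (intro sum.cong) (auto simp: algebra_simps)
    also have "\<dots> = of_nat k * R k $$ (0, j) - (\<Sum>l<n. R k $$ (0, l) * A $$ (l, j))"
      using j by simp
    finally show "of_nat k * R k $$ (0, j)
        = (if j = 0 then 1 else 0) + (\<Sum>l<n. R k $$ (0, l) * A $$ (l, j))" by (simp add: algebra_simps)
  qed
  define \<rho> where "\<rho> = (\<lambda>k. \<Sum>j<n. norm (R k $$ (0, j)))"
  define B where "B = (\<Sum>l<n. \<Sum>j<n. norm (A $$ (l, j)))"
  have B0: "B \<ge> 0" unfolding B_def by (intro sum_nonneg) auto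
  assume l: "l < n"
  have "eventually (\<lambda>k. norm (R k $$ (0, l)) \<le> 2 / real k) sequentially"
    using ev eventually_gt_at_top[of "nat \<lceil>2 * B\<rceil>"]
  proof eventually_elim
    case (elim k)
    then have k: "real k > 2 * B" "k > 0" by linarith+
    have "real k * \<rho> k = (\<Sum>j<n. norm (of_nat k * R k $$ (0, j)))"
      by (simp add: \<rho>_def sum_distrib_left norm_mult)
    also have "\<dots> \<le> (\<Sum>j<n. (if j = 0 then 1 else 0) + (\<Sum>l<n. norm (R k $$ (0, l)) * norm (A $$ (l, j))))"
    proof (rule sum_mono)
      fix j assume "j \<in> {..<n}"
      then have eq: "of_nat k * R k $$ (0, j)
          = (if j = 0 then 1 else 0) + (\<Sum>l<n. R k $$ (0, l) * A $$ (l, j))" using elim(1) by blast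
      have "norm (of_nat k * R k $$ (0, j))
          \<le> norm (if j = 0 then 1 else (0::complex)) + norm (\<Sum>l<n. R k $$ (0, l) * A $$ (l, j))"
        unfolding eq by (rule norm_triangle_ineq)
      also have "\<dots> \<le> (if j = 0 then 1 else 0) + (\<Sum>l<n. norm (R k $$ (0, l)) * norm (A $$ (l, j)))"
        by (intro add_mono) (auto simp flip: norm_mult intro: norm_sum)
      finally show "norm (of_nat k * R k $$ (0, j))
          \<le> (if j = 0 then 1 else 0) + (\<Sum>l<n. norm (R k $$ (0, l)) * norm (A $$ (l, j)))" .
    qed
    also have "\<dots> = 1 + (\<Sum>j<n. \<Sum>l<n. norm (R k $$ (0, l)) * norm (A $$ (l, j)))"
      using n by (simp add: sum.distrib)
    also have "(\<Sum>j<n. \<Sum>l<n. norm (R k $$ (0, l)) * norm (A $$ (l, j)))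
        = (\<Sum>l<n. norm (R k $$ (0, l)) * (\<Sum>j<n. norm (A $$ (l, j))))"
      by (subst sum.swap) (simp add: sum_distrib_left)
    also have "\<dots> \<le> (\<Sum>l<n. norm (R k $$ (0, l)) * B)"
    proof (intro sum_mono mult_left_mono)
      fix l assume "l \<in> {..<n}"
      then show "(\<Sum>j<n. norm (A $$ (l, j))) \<le> B"
        unfolding B_def by (intro member_le_sum) (auto intro: sum_nonneg)
    qed auto
    also have "\<dots> = \<rho> k * B" by (simp add: \<rho>_def sum_distrib_right)
    finally have *: "real k * \<rho> k \<le> 1 + \<rho> k * B" by simp
    have \<rho>0: "\<rho> k \<ge> 0" unfolding \<rho>_def by (intro sum_nonneg) auto
    have "\<rho> k * B \<le> \<rho> k * (real k / 2)" using \<rho>0 k by (intro mult_left_mono) auto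
    then have "\<rho> k * real k \<le> 2" using * by (simp add: mult.commute)
    then have "\<rho> k \<le> 2 / real k" using k by (simp add: field_simps)
    moreover have "norm (R k $$ (0, l)) \<le> \<rho> k"
      unfolding \<rho>_def using l by (intro member_le_sum) auto
    ultimately show ?case by linarith
  qed
  from Lim_null_comparison[OF this lim_const_over_n] show "(\<lambda>k. R k $$ (0, l)) \<longlonglongrightarrow> 0" .
qed

context real_simple_fibre
begin

text \<open>Multiplying by \<open>z\<close> peels off one moment on both sides: \<open>z R J\<^sup>k = J\<^sup>k + R J\<^sup>k\<^sup>+\<^sup>1\<close> for the resolvent \<open>R\<close>, and
  \<open>z y\<^sup>k/(z - y) = y\<^sup>k + y\<^sup>k\<^sup>+\<^sup>1/(z - y)\<close> for the measure. As \<open>z\<close> tends to infinity the last terms vanish, so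
  equality at stage \<open>k\<close> gives equality of the \<open>k\<close>-th moments and equality at stage \<open>k + 1\<close>.\<close>

lemma resolvent_moments:
  assumes J: "J \<in> carrier_mat d d"
    and res: "\<And>z. invertible_mat (z \<cdot>\<^sub>m 1\<^sub>m d - J) \<Longrightarrow> poly S z \<noteq> x \<Longrightarrow>
        the (mat_inverse (z \<cdot>\<^sub>m 1\<^sub>m d - J)) $$ (0, 0) =
          (poly (pderiv S) z / of_nat d) / (poly S z - x)"
  shows "(J ^\<^sub>m k) $$ (0, 0) = 1 / of_nat d * (\<Sum>y\<in>\<Lambda>. y ^ k)"
proof -
  define R where "R = (\<lambda>n::nat. the (mat_inverse (of_nat n \<cdot>\<^sub>m 1\<^sub>m d - J)))"
  define G where "G = (\<lambda>k n. \<Sum>l<d. R n $$ (0, l) * (J ^\<^sub>m k) $$ (l, 0))"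
  define s where "s = (\<lambda>k n. 1 / of_nat d * (\<Sum>y\<in>\<Lambda>. y ^ k / (of_nat n - y)))"
  define m where "m = (\<lambda>k. 1 / of_nat d * (\<Sum>y\<in>\<Lambda>. y ^ k))"
  have row1: "eventually (\<lambda>n. \<forall>j<d. of_nat n * R n $$ (0, j)
      = (if j = 0 then 1 else 0) + (\<Sum>l<d. R n $$ (0, l) * J $$ (l, j))) sequentially"
    unfolding R_def by (rule resolvent_row_tendsto_0(1)[OF J degree_pos])
  have row2: "(\<lambda>n. R n $$ (0, l)) \<longlonglongrightarrow> 0" if "l < d" for l
    unfolding R_def by (rule resolvent_row_tendsto_0(2)[OF J degree_pos that])
  have off: "eventually (\<lambda>n::nat. of_nat n \<notin> \<Lambda>) sequentially"
    by (rule eventually_of_nat_notin_finite[OF finite_nodes])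
  have G0: "G k \<longlonglongrightarrow> 0" for k
  proof -
    have "G k \<longlonglongrightarrow> (\<Sum>l<d. 0 * (J ^\<^sub>m k) $$ (l, 0))"
      unfolding G_def by (intro tendsto_sum tendsto_mult tendsto_const row2) auto
    then show ?thesis by simp
  qed
  have s0: "s k \<longlonglongrightarrow> 0" for k
  proof -
    have "s k \<longlonglongrightarrow> 1 / of_nat d * (\<Sum>y\<in>\<Lambda>. 0)"
      unfolding s_def
    proof (intro tendsto_mult tendsto_const tendsto_sum)
      fix y :: complex
      have "filterlim (\<lambda>n. - y + of_nat n) at_infinity sequentially"
        by (rule tendsto_add_filterlim_at_infinity[OF tendsto_const tendsto_of_nat])
      then have "filterlim (\<lambda>n. of_nat n - y) at_infinity sequentially" by simp
      then show "(\<lambda>n. y ^ k / (of_nat n - y)) \<longlonglongrightarrow> 0" by (rule tendsto_divide_0[OF tendsto_const])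
    qed
    then show ?thesis by simp
  qed
  have recG: "eventually (\<lambda>n. of_nat n * G k n = (J ^\<^sub>m k) $$ (0, 0) + G (Suc k) n) sequentially" for k
    using row1
  proof eventually_elim
    case (elim n)
    have "of_nat n * G k n = (\<Sum>l<d. (of_nat n * R n $$ (0, l)) * (J ^\<^sub>m k) $$ (l, 0))"
      by (simp add: G_def sum_distrib_left mult.assoc)
    also have "\<dots> = (\<Sum>l<d. (if l = 0 then (J ^\<^sub>m k) $$ (0, 0) else 0)
        + (\<Sum>j<d. R n $$ (0, j) * J $$ (j, l) * (J ^\<^sub>m k) $$ (l, 0)))"
      using elim by (intro sum.cong) (auto simp: distrib_right sum_distrib_right)
    also have "\<dots> = (J ^\<^sub>m k) $$ (0, 0) + (\<Sum>l<d. \<Sum>j<d. R n $$ (0, j) * J $$ (j, l) * (J ^\<^sub>m k) $$ (l, 0))"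
      using degree_pos by (simp add: sum.distrib)
    also have "(\<Sum>l<d. \<Sum>j<d. R n $$ (0, j) * J $$ (j, l) * (J ^\<^sub>m k) $$ (l, 0))
        = (\<Sum>j<d. \<Sum>l<d. R n $$ (0, j) * J $$ (j, l) * (J ^\<^sub>m k) $$ (l, 0))"
      by (rule sum.swap)
    also have "\<dots> = G (Suc k) n"
      unfolding G_def pow_mat_Suc_left[OF J]
      by (intro sum.cong refl)
         (simp only: lessThan_iff mult_mat_index[OF J pow_carrier_mat[OF J] _ degree_pos] sum_distrib_left mult.assoc)
    finally show ?case .
  qed
  have recs: "eventually (\<lambda>n. of_nat n * s k n = m k + s (Suc k) n) sequentially" for k
    using off
  proof eventually_elim
    case (elim n)
    have "of_nat n * (y ^ k / (of_nat n - y)) = y ^ k + y ^ Suc k / (of_nat n - y)" if "y \<in> \<Lambda>" for y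
    proof -
      have "of_nat n - y \<noteq> 0" using elim that by auto
      then show ?thesis by (simp add: field_simps)
    qed
    then have "(\<Sum>y\<in>\<Lambda>. of_nat n * (y ^ k / (of_nat n - y))) = (\<Sum>y\<in>\<Lambda>. y ^ k) + (\<Sum>y\<in>\<Lambda>. y ^ Suc k / (of_nat n - y))"
      unfolding sum.distrib[symmetric] by (intro sum.cong) auto
    then show ?case
      unfolding s_def m_def distrib_left[symmetric] mult.left_commute[of "of_nat n"] sum_distrib_left[of "of_nat n"]
      by simp
  qed
  have const: "(J ^\<^sub>m k) $$ (0, 0) = m k" if eq: "eventually (\<lambda>n. G k n = s k n) sequentially" for k
  proof -
    have "eventually (\<lambda>n. s (Suc k) n - G (Suc k) n = (J ^\<^sub>m k) $$ (0, 0) - m k) sequentially"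
      using eq recG[of k] recs[of k]
    proof eventually_elim
      case (elim n)
      then have "(J ^\<^sub>m k) $$ (0, 0) + G (Suc k) n = m k + s (Suc k) n" by metis
      then show ?case by (simp add: algebra_simps)
    qed
    then have "(\<lambda>n. s (Suc k) n - G (Suc k) n) \<longlonglongrightarrow> (J ^\<^sub>m k) $$ (0, 0) - m k"
      by (rule tendsto_eventually)
    moreover have "(\<lambda>n. s (Suc k) n - G (Suc k) n) \<longlonglongrightarrow> 0 - 0" by (rule tendsto_diff[OF s0 G0])
    ultimately have "(J ^\<^sub>m k) $$ (0, 0) - m k = 0 - 0" by (rule LIMSEQ_unique)
    then show ?thesis by simp
  qed
  have "eventually (\<lambda>n. G k n = s k n) sequentially" for k
  proof (induction k)
    case 0
    show ?case
      using eventually_invertible_mat[OF J] off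
    proof eventually_elim
      case (elim n)
      have "G 0 n = (\<Sum>l<d. if l = 0 then R n $$ (0, 0) else 0)"
        unfolding G_def using J degree_pos by (intro sum.cong) auto
      also have "\<dots> = R n $$ (0, 0)" using degree_pos by simp
      also have "\<dots> = s 0 n"
        unfolding R_def s_def using res[OF elim(1)] elim(2) fibre_log_derivative[OF elim(2)] by simp
      finally show ?case .
    qed
  next
    case (Suc k)
    show ?case
      using Suc recG[of k] recs[of k]
    proof eventually_elim
      case (elim n)
      then have "(J ^\<^sub>m k) $$ (0, 0) + G (Suc k) n = m k + s (Suc k) n" by metis
      then show ?case using const[OF Suc] by simp
    qed
  qed
  from const[OF this] show ?thesis by (simp add: m_def)
qed

end

text \<open>The three-term recurrence, solved for the next polynomial: column \<open>m\<close> of \<open>J\<close> expresses \<open>|m + 1\<rangle>\<close> through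
  \<open>J|m\<rangle>\<close>, \<open>|m\<rangle>\<close> and \<open>|m - 1\<rangle>\<close>, because the entry at \<open>(m + 1, m)\<close> is not zero.\<close>

lemma jacobi_orthonormal_polys:
  assumes jac: "jacobi_matrix d J" and d: "d > 0"
  shows "k < d \<Longrightarrow> \<exists>Q. real_coeffs Q \<and> degree Q = k \<and> Re (lead_coeff Q) > 0 \<and>
    (\<forall>i<d. poly_mat Q J $$ (i, 0) = (if i = k then 1 else 0))"
proof (induction k rule: less_induct)
  case (less k)
  have J: "J \<in> carrier_mat d d" and real: "\<And>i j. i < d \<Longrightarrow> j < d \<Longrightarrow> J $$ (i, j) \<in> \<real>"
    and sym: "\<And>i j. i < d \<Longrightarrow> j < d \<Longrightarrow> J $$ (i, j) = J $$ (j, i)"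
    and zero: "\<And>i j. i < d \<Longrightarrow> j < d \<Longrightarrow> i + 1 < j \<Longrightarrow> J $$ (i, j) = 0"
    and pos: "\<And>i. i + 1 < d \<Longrightarrow> Re (J $$ (i, i + 1)) > 0"
    using jac unfolding jacobi_matrix_def by blast+
  have dim: "dim_row (poly_mat p J) = d" "dim_col (poly_mat p J) = d" for p
    using poly_mat_carrier[OF J] by auto
  define v where "v = (\<lambda>p i. poly_mat p J $$ (i, 0))"
  have v_add: "v (p + q) i = v p i + v q i" if "i < d" for p q i
    using that d by (simp add: v_def poly_mat_add[OF J] dim)
  have v_smult: "v (Polynomial.smult c p) i = c * v p i" if "i < d" for c p i
    using that d by (simp add: v_def poly_mat_smult[OF J] dim)
  have v_pCons: "v (pCons a p) i = (if i = 0 then a else 0) + (\<Sum>l<d. J $$ (i, l) * v p l)" if "i < d" for a p i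
  proof -
    have "v (pCons a p) i = (if i = 0 then a else 0) + (J * poly_mat p J) $$ (i, 0)"
      using that J d unfolding v_def poly_mat_pCons[OF J] by (simp add: dim del: index_mult_mat(1))
    then show ?thesis by (simp only: mult_mat_index[OF J poly_mat_carrier[OF J] that d] v_def)
  qed
  have v0: "v 0 i = 0" if "i < d" for i using that d J by (simp add: v_def poly_mat_0[OF J])
  show ?case
  proof (cases k)
    case 0
    have "v 1 i = (if i = 0 then 1 else 0)" if "i < d" for i
      using v_pCons[OF that, of 1 0] v0 by (simp add: one_pCons)
    moreover have "real_coeffs 1" by (auto simp: real_coeffs_def)
    ultimately show ?thesis using 0 by (intro exI[of _ 1]) (auto simp: v_def)
  next
    case (Suc m)
    have m: "m < d" "Suc m < d" using less.prems Suc by auto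
    obtain Q where Q: "real_coeffs Q" "degree Q = m" "Re (lead_coeff Q) > 0"
      "\<And>i. i < d \<Longrightarrow> v Q i = (if i = m then 1 else 0)"
      using less.IH[of m] m Suc by (auto simp: v_def)
    \<comment> \<open>the term of the recurrence that comes from \<open>|m - 1\<rangle>\<close>, absent for \<open>m = 0\<close>\<close>
    obtain Q' where Q': "real_coeffs Q'" "degree Q' \<le> m"
      "\<And>i. i < d \<Longrightarrow> v Q' i = (if i + 1 = m then J $$ (i, m) else 0)"
    proof (cases m)
      case 0
      then show ?thesis using that[of 0] v0 by (simp add: real_coeffs_def)
    next
      case (Suc l)
      then obtain U where U: "real_coeffs U" "degree U = l"
        "\<And>i. i < d \<Longrightarrow> v U i = (if i = l then 1 else 0)"
        using less.IH[of l] m \<open>k = Suc m\<close> by (auto simp: v_def)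
      have "J $$ (l, m) \<in> \<real>" using real m Suc by simp
      show ?thesis
      proof (rule that[of "Polynomial.smult (J $$ (l, m)) U"])
        show "real_coeffs (Polynomial.smult (J $$ (l, m)) U)"
          using U(1) \<open>J $$ (l, m) \<in> \<real>\<close> by (auto simp: real_coeffs_def)
        show "degree (Polynomial.smult (J $$ (l, m)) U) \<le> m" using U(2) Suc by (simp add: degree_smult_le le_trans)
        show "v (Polynomial.smult (J $$ (l, m)) U) i = (if i + 1 = m then J $$ (i, m) else 0)" if "i < d" for i
          using that U(3) Suc by (auto simp: v_smult)
      qed
    qed
    obtain b where b: "J $$ (m, Suc m) = complex_of_real b" "b > 0"
      using real[of m "Suc m"] pos[of m] m by (auto elim!: Reals_cases)
    have bsym: "J $$ (Suc m, m) = complex_of_real b" using sym[of "Suc m" m] m b by simp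
    define V where "V = pCons 0 Q + Polynomial.smult (- J $$ (m, m)) Q + Polynomial.smult (-1) Q'"
    define W where "W = Polynomial.smult (complex_of_real (1 / b)) V"
    have vV: "v V i = (if i = Suc m then complex_of_real b else 0)" if i: "i < d" for i
    proof -
      have "(\<Sum>l<d. J $$ (i, l) * v Q l) = (\<Sum>l<d. if l = m then J $$ (i, m) else 0)"
        by (intro sum.cong) (auto simp: Q(4))
      also have "\<dots> = J $$ (i, m)" using m by simp
      finally have "v (pCons 0 Q) i = J $$ (i, m)" using v_pCons[OF i, of 0 Q] by simp
      then have vVi: "v V i = J $$ (i, m) - (if i = m then J $$ (m, m) else 0) - (if i + 1 = m then J $$ (i, m) else 0)"
        unfolding V_def by (simp only: v_add[OF i] v_smult[OF i] Q(4)[OF i] Q'(3)[OF i]) simp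
      consider "i + 1 < m" | "i + 1 = m" | "i = m" | "i = Suc m" | "Suc m < i" by linarith
      then show ?thesis
      proof cases
        case 1 then show ?thesis using vVi zero[OF i m(1)] by simp
      next
        case 5 then show ?thesis using vVi zero[OF m(1) i] sym[OF i m(1)] by simp
      qed (use vVi bsym in auto)
    qed
    then have "v W i = (if i = Suc m then 1 else 0)" if "i < d" for i
      using that b(2) by (simp add: W_def v_smult)
    moreover have "real_coeffs W"
      using Q(1) Q'(1) real[OF m(1) m(1)] unfolding real_coeffs_def W_def V_def
      by (auto simp: coeff_pCons split: nat.splits intro!: Reals_add Reals_mult Reals_diff simp del: of_real_divide)
    moreover have cV: "coeff V (Suc m) = lead_coeff Q"
      using Q(2) Q'(2) by (simp add: V_def coeff_eq_0)
    moreover have "degree W = Suc m"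
    proof (rule antisym)
      show "degree W \<le> Suc m"
        using Q(2) Q'(2) by (intro degree_le) (auto simp: W_def V_def coeff_eq_0 coeff_pCons split: nat.splits)
      show "Suc m \<le> degree W"
        using cV Q(3) b(2) by (intro le_degree) (auto simp: W_def)
    qed
    ultimately show ?thesis
      using Suc Q(3) b(2) by (intro exI[of _ W]) (auto simp: v_def W_def simp del: of_real_divide)
  qed
qed

context real_simple_fibre
begin

text \<open>By the moments, the inner product of polynomials is that of the corresponding vectors \<open>p(J)|0\<rangle>\<close>. So the
  polynomials \<open>Q k\<close> with \<open>Q\<^sub>k(J)|0\<rangle> = |k\<rangle>\<close> are orthonormal on the fibre, hence equal to \<open>P k\<close>, and the
  entries of \<open>J\<close> are the inner products \<open>\<langle>y P\<^sub>j, P\<^sub>i\<rangle>\<close>.\<close>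

lemma jacobi_matrix_unique:
  assumes P: "orthonormal P d" and jac: "jacobi_matrix d J"
    and moments: "\<And>k. (J ^\<^sub>m k) $$ (0, 0) = 1 / of_nat d * (\<Sum>y\<in>\<Lambda>. y ^ k)"
  shows "J = jac P"
proof -
  have J: "J \<in> carrier_mat d d" and sym: "\<And>i j. i < d \<Longrightarrow> j < d \<Longrightarrow> J $$ (i, j) = J $$ (j, i)"
    using jac unfolding jacobi_matrix_def by blast+
  have dim: "dim_row (poly_mat p J) = d" "dim_col (poly_mat p J) = d" for p
    using poly_mat_carrier[OF J] by auto
  have functional: "poly_mat p J $$ (0, 0) = 1 / of_nat d * (\<Sum>y\<in>\<Lambda>. poly p y)" for p
  proof -
    have "poly_mat p J $$ (0, 0) = (\<Sum>k\<le>degree p. \<Sum>y\<in>\<Lambda>. 1 / of_nat d * (coeff p k * y ^ k))"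
      unfolding poly_mat_index[OF J degree_pos degree_pos order_refl] moments sum_distrib_left
      by (simp only: mult_ac)
    also have "\<dots> = (\<Sum>y\<in>\<Lambda>. \<Sum>k\<le>degree p. 1 / of_nat d * (coeff p k * y ^ k))" by (rule sum.swap)
    finally show ?thesis unfolding poly_altdef[of p] by (simp only: sum_distrib_left)
  qed
  have inner_eq: "inner p q = (\<Sum>l<d. poly_mat p J $$ (l, 0) * poly_mat q J $$ (l, 0))"
    if q: "real_coeffs q" for p q
  proof -
    have "cnj (poly q y) = poly q y" if "y \<in> \<Lambda>" for y
      using real_coeffs_poly[OF q] fibre_real that by (simp add: Reals_cnj_iff)
    then have "inner p q = 1 / of_nat d * (\<Sum>y\<in>\<Lambda>. poly (p * q) y)"
      unfolding root_inner_def by simp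
    also have "\<dots> = (poly_mat p J * poly_mat q J) $$ (0, 0)"
      by (simp only: functional[symmetric] poly_mat_mult[OF J])
    also have "\<dots> = (\<Sum>l<d. poly_mat p J $$ (0, l) * poly_mat q J $$ (l, 0))"
      by (rule mult_mat_index[OF poly_mat_carrier[OF J] poly_mat_carrier[OF J] degree_pos degree_pos])
    also have "\<dots> = (\<Sum>l<d. poly_mat p J $$ (l, 0) * poly_mat q J $$ (l, 0))"
      using poly_mat_symmetric[OF J sym degree_pos] by (intro sum.cong) auto
    finally show ?thesis .
  qed
  have "\<forall>k. \<exists>Q. k < d \<longrightarrow> real_coeffs Q \<and> degree Q = k \<and> Re (lead_coeff Q) > 0 \<and>
    (\<forall>i<d. poly_mat Q J $$ (i, 0) = (if i = k then 1 else 0))"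
    using jacobi_orthonormal_polys[OF jac degree_pos] by blast
  from choice[OF this] obtain Q where Q: "\<And>k. k < d \<Longrightarrow> real_coeffs (Q k)"
    "\<And>k. k < d \<Longrightarrow> degree (Q k) = k" "\<And>k. k < d \<Longrightarrow> Re (lead_coeff (Q k)) > 0"
    and vQ: "\<And>k i. k < d \<Longrightarrow> i < d \<Longrightarrow> poly_mat (Q k) J $$ (i, 0) = (if i = k then 1 else 0)"
    by blast
  have pick: "(\<Sum>l<d. f l * poly_mat (Q i) J $$ (l, 0)) = f i" if "i < d" for f i
  proof -
    have "(\<Sum>l<d. f l * poly_mat (Q i) J $$ (l, 0)) = (\<Sum>l<d. if l = i then f i else 0)"
      by (intro sum.cong) (auto simp: vQ that)
    then show ?thesis using that by simp
  qed
  have "orthonormal Q d"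
    unfolding orthonormal_def
  proof (intro allI impI conjI)
    fix k assume k: "k < d"
    show "lead_coeff (Q k) \<in> \<real>" using Q(1)[OF k] by (auto simp: real_coeffs_def)
    show "inner (Q j) (Q k) = (if j = k then 1 else 0)" if "j < d" for j
      unfolding inner_eq[OF Q(1)[OF k]] pick[OF k] using vQ[OF that k] by auto
  qed (use Q in auto)
  then have PQ: "P k = Q k" if "k < d" for k using orthonormal_unique[OF P] that by blast
  show ?thesis
  proof (rule eq_matI)
    fix i j assume "i < dim_row (jac P)" "j < dim_col (jac P)"
    then have ij: "i < d" "j < d" by (auto simp: fmat_def)
    have "jac P $$ (i, j) = inner (pCons 0 (Q j)) (Q i)"
      unfolding jac_index[OF ij] using PQ ij by simp
    also have "\<dots> = poly_mat (pCons 0 (Q j)) J $$ (i, 0)"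
      unfolding inner_eq[OF Q(1)[OF ij(1)]] by (rule pick[OF ij(1)])
    also have "\<dots> = (J * poly_mat (Q j) J) $$ (i, 0)"
      unfolding poly_mat_pCons[OF J] using ij(1) J degree_pos by (simp add: dim del: index_mult_mat(1))
    also have "\<dots> = J $$ (i, j)"
      unfolding mult_mat_index[OF J poly_mat_carrier[OF J] ij(1) degree_pos] by (rule pick[OF ij(2)])
    finally show "J $$ (i, j) = jac P $$ (i, j)" by simp
  qed (use J in \<open>auto simp: fmat_def\<close>)
qed

lemma jacobi_of_eq:
  assumes P: "orthonormal P d"
  shows "jacobi_of S x = jac P"
  unfolding jacobi_of_def Let_def
proof (rule the_equality)
  show "jacobi_matrix d (jac P) \<and> (\<forall>z. invertible_mat (z \<cdot>\<^sub>m 1\<^sub>m d - jac P) \<and> poly S z \<noteq> x \<longrightarrow>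
      the (mat_inverse (z \<cdot>\<^sub>m 1\<^sub>m d - jac P)) $$ (0, 0) = (poly (pderiv S) z / of_nat d) / (poly S z - x))"
    using jacobi_matrix_jac[OF P] jac_resolvent[OF P] by simp
next
  fix J assume J: "jacobi_matrix d J \<and> (\<forall>z. invertible_mat (z \<cdot>\<^sub>m 1\<^sub>m d - J) \<and> poly S z \<noteq> x \<longrightarrow>
      the (mat_inverse (z \<cdot>\<^sub>m 1\<^sub>m d - J)) $$ (0, 0) = (poly (pderiv S) z / of_nat d) / (poly S z - x))"
  then have "J \<in> carrier_mat d d" by (simp add: jacobi_matrix_def)
  then show "J = jac P"
    using J by (intro jacobi_matrix_unique[OF P] resolvent_moments) auto
qed

lemma orthonormal_orthonormal_polys: "orthonormal (orthonormal_polys S x) d"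
  using someI_ex[OF orthonormal_exists[OF order_refl]]
  unfolding orthonormal_polys_def orthonormal_def .

end


section \<open>The trace of FD* FD\<close>

lemma mat_trace_adjoint_mult:
  fixes A :: "complex mat"
  assumes A: "A \<in> carrier_mat n n"
  shows "mat_trace (mat_adjoint A * A) = (\<Sum>k<n. \<Sum>i<n. A $$ (i, k) * cnj (A $$ (i, k)))"
proof -
  have adj: "mat_adjoint A \<in> carrier_mat n n" using A by (auto simp: mat_adjoint_def)
  have idx: "mat_adjoint A $$ (k, i) = cnj (A $$ (i, k))" if "i < n" "k < n" for i k
    using A that by (simp add: mat_adjoint_def mat_of_rows_def)
  have "(mat_adjoint A * A) $$ (k, k) = (\<Sum>i<n. A $$ (i, k) * cnj (A $$ (i, k)))" if "k < n" for k
    unfolding mult_mat_index[OF adj A that that]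
    using that by (intro sum.cong refl) (simp add: idx mult.commute)
  then show ?thesis using adj by (simp add: mat_trace_def)
qed

context real_simple_fibre
begin

text \<open>The Lagrange polynomial of the root \<open>b\<close>: the product has the value \<open>S'(b)\<close>, divided by the leading
  coefficient, at \<open>b\<close>.\<close>

definition lagrange :: "complex \<Rightarrow> complex poly" where
  "lagrange b = Polynomial.smult (lead_coeff S / poly (pderiv S) b) (\<Prod>y\<in>\<Lambda> - {b}. [:-y, 1:])"

lemma fibre_factor:
  assumes b: "b \<in> \<Lambda>"
  shows "S - [:x:] = [:-b, 1:] * Polynomial.smult (poly (pderiv S) b) (lagrange b)"
proof -
  have nz: "poly (pderiv S) b \<noteq> 0" using fibre_simple b by simp
  have "S - [:x:] = Polynomial.smult (lead_coeff S) (\<Prod>y\<in>\<Lambda>. [:-y, 1:])"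
    by (rule card_simple_fibre(2)[OF degree_pos fibre_simple])
  also have "(\<Prod>y\<in>\<Lambda>. [:-y, 1:]) = [:-b, 1:] * (\<Prod>y\<in>\<Lambda> - {b}. [:-y, 1:])"
    by (rule prod.remove[OF finite_nodes b])
  finally have "S - [:x:] = Polynomial.smult (lead_coeff S) ([:-b, 1:] * (\<Prod>y\<in>\<Lambda> - {b}. [:-y, 1:]))" .
  moreover have "Polynomial.smult (poly (pderiv S) b) (lagrange b)
      = Polynomial.smult (lead_coeff S) (\<Prod>y\<in>\<Lambda> - {b}. [:-y, 1:])"
    using nz by (simp add: lagrange_def)
  ultimately show ?thesis by (simp only: mult_smult_right)
qed

text \<open>Here \<open>Q = (S - x) / (z - b)\<close>. At \<open>z = b\<close> the first summands vanish, so \<open>Q\<close>, \<open>Q'\<close> and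
  \<open>Q''\<close> are \<open>S'\<close>, \<open>S''/2\<close> and \<open>S'''/3\<close> there.\<close>

lemma fibre_derivs:
  assumes b: "b \<in> \<Lambda>"
  defines "Q \<equiv> Polynomial.smult (poly (pderiv S) b) (lagrange b)"
  shows "poly (pderiv S) z = (z - b) * poly (pderiv Q) z + poly Q z"
    and "poly (pderiv (pderiv S)) z = (z - b) * poly (pderiv (pderiv Q)) z + 2 * poly (pderiv Q) z"
    and "poly (pderiv (pderiv (pderiv S))) z
      = (z - b) * poly (pderiv (pderiv (pderiv Q))) z + 3 * poly (pderiv (pderiv Q)) z"
proof -
  have "pderiv S = pderiv (S - [:x:])" by (simp add: pderiv_diff pderiv_pCons)
  then have S': "pderiv S = pderiv ([:-b, 1:] * Q)" unfolding fibre_factor[OF b] Q_def .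
  show "poly (pderiv S) z = (z - b) * poly (pderiv Q) z + poly Q z"
    unfolding S' pderiv_mult by (simp add: pderiv_pCons algebra_simps)
  show "poly (pderiv (pderiv S)) z = (z - b) * poly (pderiv (pderiv Q)) z + 2 * poly (pderiv Q) z"
    unfolding S' pderiv_mult pderiv_add by (simp add: pderiv_pCons algebra_simps)
  show "poly (pderiv (pderiv (pderiv S))) z
      = (z - b) * poly (pderiv (pderiv (pderiv Q))) z + 3 * poly (pderiv (pderiv Q)) z"
    unfolding S' pderiv_mult pderiv_add by (simp add: pderiv_pCons algebra_simps)
qed

lemma lagrange_eval:
  assumes "a \<in> \<Lambda>" "b \<in> \<Lambda>"
  shows "poly (lagrange b) a = (if a = b then 1 else 0)"
proof (cases "a = b")
  case True
  then show ?thesis using fibre_derivs(1)[OF assms(2), of b] fibre_simple assms by simp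
next
  case False
  then show ?thesis using assms finite_nodes by (simp add: lagrange_def poly_prod)
qed

lemma degree_lagrange: "b \<in> \<Lambda> \<Longrightarrow> degree (lagrange b) < d"
proof -
  assume b: "b \<in> \<Lambda>"
  have "degree (lagrange b) \<le> degree (\<Prod>y\<in>\<Lambda> - {b}. [:-y, 1:])"
    unfolding lagrange_def by (rule degree_smult_le)
  also have "\<dots> = card (\<Lambda> - {b})" by (subst degree_prod_sum_eq) auto
  also have "\<dots> < card \<Lambda>" using finite_nodes b by (rule card_Diff1_less)
  finally show ?thesis by (simp only: card_fibre)
qed

lemma lagrange_deriv:
  assumes ab: "a \<in> \<Lambda>" "b \<in> \<Lambda>"
  shows "poly (pderiv (lagrange b)) a / poly (pderiv S) a
    = (if a = b then poly (pderiv (pderiv S)) b / (2 * (poly (pderiv S) b)\<^sup>2)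
       else 1 / ((a - b) * poly (pderiv S) b))"
proof -
  have nz: "poly (pderiv S) a \<noteq> 0" "poly (pderiv S) b \<noteq> 0" using fibre_simple ab by auto
  show ?thesis
  proof (cases "a = b")
    case True
    have "poly (pderiv (pderiv S)) b = 2 * (poly (pderiv S) b * poly (pderiv (lagrange b)) b)"
      using fibre_derivs(2)[OF ab(2), of b] by (simp add: pderiv_smult)
    then show ?thesis using True nz by (simp add: power2_eq_square)
  next
    case False
    have "poly (pderiv S) a = (a - b) * (poly (pderiv S) b * poly (pderiv (lagrange b)) a)"
      using fibre_derivs(1)[OF ab(2), of a] lagrange_eval[OF ab] False by (simp add: pderiv_smult)
    then have "poly (pderiv (lagrange b)) a = poly (pderiv S) a / ((a - b) * poly (pderiv S) b)"
      using False nz by (simp add: field_simps)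
    then have "poly (pderiv (lagrange b)) a / poly (pderiv S) a = 1 / ((a - b) * poly (pderiv S) b)"
      using nz by simp
    then show ?thesis using False by simp
  qed
qed

lemma lagrange_deriv_real:
  assumes "a \<in> \<Lambda>" "b \<in> \<Lambda>"
  shows "poly (pderiv (lagrange b)) a / poly (pderiv S) a \<in> \<real>"
  unfolding lagrange_deriv[OF assms]
  using assms fibre_real real_coeffs real_coeffs_pderiv
  by (auto intro!: Reals_divide Reals_mult Reals_power Reals_diff Reals_minus real_coeffs_poly)

text \<open>With \<open>l\<close> the Lagrange polynomial of \<open>b\<close>, the diagonal term is \<open>l'(b)\<^sup>2/S'(b)\<^sup>2\<close>, and the off-diagonal ones
  add up to \<open>(l'(b)\<^sup>2 - l''(b))/S'(b)\<^sup>2\<close> by \<open>pderiv_prod_linear\<close>, as \<open>l(b) = 1\<close>. Substituting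
  \<open>l' = S''/(2S')\<close> and \<open>l'' = S'''/(3S')\<close> at \<open>b\<close> gives the Schwarzian.\<close>

lemma sum_lagrange_deriv:
  assumes b: "b \<in> \<Lambda>"
  shows "(\<Sum>a\<in>\<Lambda>. (poly (pderiv (lagrange b)) a / poly (pderiv S) a)\<^sup>2)
    = - (1 / 3) * (schwarzian S b / (poly (pderiv S) b)\<^sup>2)"
proof -
  let ?s1 = "poly (pderiv S) b" and ?s2 = "poly (pderiv (pderiv S)) b" and ?s3 = "poly (pderiv (pderiv (pderiv S))) b"
  let ?l = "lagrange b"
  have nz: "?s1 \<noteq> 0" using fibre_simple b by simp
  have l0: "poly ?l b = 1" using lagrange_eval[OF b b] by simp
  have l1: "poly (pderiv ?l) b = ?s2 / (2 * ?s1)"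
    using fibre_derivs(2)[OF b, of b] nz by (simp add: pderiv_smult)
  have l2: "poly (pderiv (pderiv ?l)) b = ?s3 / (3 * ?s1)"
    using fibre_derivs(3)[OF b, of b] nz by (simp add: pderiv_smult)
  define \<sigma> where "\<sigma> = (\<Sum>a\<in>\<Lambda> - {b}. 1 / (b - a)\<^sup>2)"
  have \<sigma>: "(poly (pderiv ?l) b)\<^sup>2 - poly ?l b * poly (pderiv (pderiv ?l)) b = (poly ?l b)\<^sup>2 * \<sigma>"
  proof -
    let ?P = "\<Prod>y\<in>\<Lambda> - {b}. [:-y, 1:]" and ?c = "lead_coeff S / poly (pderiv S) b"
    have "(poly (pderiv ?P) b)\<^sup>2 - poly ?P b * poly (pderiv (pderiv ?P)) b = (poly ?P b)\<^sup>2 * \<sigma>"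
      using pderiv_prod_linear(2)[of b "mset_set (\<Lambda> - {b})"] finite_nodes unfolding \<sigma>_def
      by (simp only: prod_unfold_prod_mset sum_unfold_sum_mset finite_set_mset_mset_set finite_Diff
          Diff_iff singleton_iff simp_thms)
    then have "?c\<^sup>2 * ((poly (pderiv ?P) b)\<^sup>2 - poly ?P b * poly (pderiv (pderiv ?P)) b)
        = ?c\<^sup>2 * ((poly ?P b)\<^sup>2 * \<sigma>)" by (simp only:)
    then show ?thesis
      unfolding lagrange_def pderiv_smult poly_smult
      by (simp only: power_mult_distrib power2_eq_square right_diff_distrib mult_ac)
  qed
  have "(\<Sum>a\<in>\<Lambda>. (poly (pderiv ?l) a / poly (pderiv S) a)\<^sup>2)
    = (poly (pderiv ?l) b / ?s1)\<^sup>2 + (\<Sum>a\<in>\<Lambda> - {b}. (poly (pderiv ?l) a / poly (pderiv S) a)\<^sup>2)"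
    by (rule sum.remove[OF finite_nodes b])
  also have "(\<Sum>a\<in>\<Lambda> - {b}. (poly (pderiv ?l) a / poly (pderiv S) a)\<^sup>2)
      = (\<Sum>a\<in>\<Lambda> - {b}. 1 / ?s1\<^sup>2 * (1 / (b - a)\<^sup>2))"
    using b by (intro sum.cong refl) (auto simp: lagrange_deriv power_divide power_mult_distrib power2_commute[of b] mult.commute)
  also have "\<dots> = 1 / ?s1\<^sup>2 * \<sigma>" by (simp only: sum_distrib_left \<sigma>_def)
  also have "\<sigma> = (?s2 / (2 * ?s1))\<^sup>2 - ?s3 / (3 * ?s1)" using \<sigma> unfolding l0 l1 l2 by simp
  also have "(poly (pderiv ?l) b / ?s1)\<^sup>2 + 1 / ?s1\<^sup>2 * ((?s2 / (2 * ?s1))\<^sup>2 - ?s3 / (3 * ?s1))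
      = - (1 / 3) * (schwarzian S b / ?s1\<^sup>2)"
    unfolding l1 schwarzian_def using nz by (simp add: field_simps power2_eq_square)
  finally show ?thesis .
qed

lemma F_mat_eq:
  assumes P: "orthonormal P d"
  shows "F_mat S x = fmat P (\<lambda>y. 1 / poly (pderiv S) y)"
  unfolding F_mat_def jacobi_of_eq[OF P] poly_mat_jac[OF P]
  by (rule fmat_inverse[OF P]) (use fibre_simple in simp)

lemma D_mat_carrier: "D_mat S x \<in> carrier_mat d d"
  unfolding D_mat_def Let_def by (rule carrier_matI) (simp_all add: mat_of_cols_def)

text \<open>The vector \<open>FD|k\<rangle>\<close> is the function \<open>P\<^sub>k'/S'\<close> on the fibre.\<close>

lemma FD_mat_index:
  assumes ik: "i < d" "k < d"
  defines "P \<equiv> orthonormal_polys S x"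
  shows "FD_mat S x $$ (i, k) = 1 / of_nat d *
    (\<Sum>a\<in>\<Lambda>. poly (pderiv (P k)) a / poly (pderiv S) a * cnj (poly (P i) a))"
proof -
  have P': "orthonormal P d" unfolding P_def by (rule orthonormal_orthonormal_polys)
  have D_index: "D_mat S x $$ (l, k) = fmat P (poly (pderiv (P k))) $$ (l, 0)" if l: "l < d" for l
    unfolding D_mat_def Let_def jacobi_of_eq[OF P'] poly_mat_jac[OF P'] P_def[symmetric]
    using l ik degree_pos by (subst mat_of_cols_index) (auto simp: fmat_def)
  have "FD_mat S x $$ (i, k) = (\<Sum>l<d. fmat P (\<lambda>y. 1 / poly (pderiv S) y) $$ (i, l) * D_mat S x $$ (l, k))"
    unfolding FD_mat_def F_mat_eq[OF P'] by (rule mult_mat_index[OF fmat_carrier D_mat_carrier ik])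
  also have "\<dots> = (\<Sum>l<d. fmat P (\<lambda>y. 1 / poly (pderiv S) y) $$ (i, l) * fmat P (poly (pderiv (P k))) $$ (l, 0))"
    using D_index by (intro sum.cong) auto
  also have "\<dots> = fmat P (\<lambda>y. 1 / poly (pderiv S) y * poly (pderiv (P k)) y) $$ (i, 0)"
    unfolding fmat_mult[OF P', symmetric]
    by (rule mult_mat_index[OF fmat_carrier fmat_carrier ik(1) degree_pos, symmetric])
  finally show ?thesis by (simp add: fmat_index ik degree_pos orthonormal_0[OF P'])
qed

lemma lagrange_expansion:
  assumes p: "degree p < d"
  shows "p = (\<Sum>b\<in>\<Lambda>. Polynomial.smult (poly p b) (lagrange b))"
proof (rule poly_eqI_degree[of \<Lambda>])
  fix a assume a: "a \<in> \<Lambda>"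
  have "poly (\<Sum>b\<in>\<Lambda>. Polynomial.smult (poly p b) (lagrange b)) a = (\<Sum>b\<in>\<Lambda>. if b = a then poly p a else 0)"
    unfolding poly_sum using a by (intro sum.cong) (auto simp: lagrange_eval)
  then show "poly p a = poly (\<Sum>b\<in>\<Lambda>. Polynomial.smult (poly p b) (lagrange b)) a"
    using a finite_nodes by simp
next
  show "degree p < card \<Lambda>" using p by (simp only: card_fibre)
  show "degree (\<Sum>b\<in>\<Lambda>. Polynomial.smult (poly p b) (lagrange b)) < card \<Lambda>"
    unfolding card_fibre
    by (rule degree_sum_less) (use degree_pos degree_lagrange degree_smult_le le_less_trans in blast)+
qed

text \<open>The trace is the sum of \<open>|P\<^sub>k'(a)/S'(a)|\<^sup>2/d\<close> over the roots \<open>a\<close> and over \<open>k\<close>. Expanding \<open>P\<^sub>k\<close> in Lagrange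
  polynomials and using completeness in \<open>k\<close> passes from the basis of orthonormal polynomials to the
  Lagrange basis, where \<open>sum_lagrange_deriv\<close> applies column by column.\<close>

lemma trace_FD:
  "1 / of_nat d * mat_trace (mat_adjoint (FD_mat S x) * FD_mat S x)
    = - (1 / 3) * (1 / of_nat d * (\<Sum>y\<in>\<Lambda>. schwarzian S y / (poly (pderiv S) y)\<^sup>2))"
proof -
  define P where "P = orthonormal_polys S x"
  have P: "orthonormal P d" unfolding P_def by (rule orthonormal_orthonormal_polys)
  note FD = FD_mat_index[folded P_def]
  define w where "w = (\<lambda>k a. poly (pderiv (P k)) a / poly (pderiv S) a)"
  define K where "K = (\<lambda>a b. poly (pderiv (lagrange b)) a / poly (pderiv S) a)"
  have FDc: "FD_mat S x \<in> carrier_mat d d"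
    unfolding FD_mat_def F_mat_eq[OF P] by (rule mult_carrier_mat[OF fmat_carrier D_mat_carrier])
  have column: "(\<Sum>i<d. FD_mat S x $$ (i, k) * cnj (FD_mat S x $$ (i, k)))
      = 1 / of_nat d * (\<Sum>a\<in>\<Lambda>. w k a * cnj (w k a))" if k: "k < d" for k
  proof -
    have "(\<Sum>i<d. FD_mat S x $$ (i, k) * cnj (FD_mat S x $$ (i, k)))
      = (\<Sum>i<d. 1 / of_nat d * (1 / of_nat d) * ((\<Sum>a\<in>\<Lambda>. cnj (w k a) * poly (P i) a) * (\<Sum>b\<in>\<Lambda>. w k b * cnj (poly (P i) b))))"
      by (intro sum.cong refl) (simp add: FD k w_def)
    also have "\<dots> = 1 / of_nat d * (1 / of_nat d) * (of_nat d * (\<Sum>a\<in>\<Lambda>. cnj (w k a) * w k a))"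
      unfolding sum_distrib_left[symmetric] sum_complete[OF P] ..
    also have "\<dots> = 1 / of_nat d * (\<Sum>a\<in>\<Lambda>. w k a * cnj (w k a))"
      using degree_pos by (simp add: mult.commute)
    finally show ?thesis .
  qed
  have wK: "w k a = (\<Sum>b\<in>\<Lambda>. K a b * poly (P k) b)" if k: "k < d" for k a
  proof -
    have "degree (P k) < d" using orthonormal_imp(1)[OF P k] k by simp
    from arg_cong[OF lagrange_expansion[OF this], of "\<lambda>p. poly (pderiv p) a / poly (pderiv S) a"]
    show ?thesis
      by (simp add: w_def K_def pderiv_sum pderiv_smult poly_sum sum_divide_distrib mult.commute)
  qed
  have row: "(\<Sum>k<d. w k a * cnj (w k a)) = of_nat d * (\<Sum>b\<in>\<Lambda>. (K a b)\<^sup>2)" if a: "a \<in> \<Lambda>" for a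
  proof -
    have "cnj (K a b) = K a b" if "b \<in> \<Lambda>" for b
      using lagrange_deriv_real[OF a that] by (simp add: K_def Reals_cnj_iff)
    then have "cnj (w k a) = (\<Sum>b\<in>\<Lambda>. K a b * cnj (poly (P k) b))" if "k < d" for k
      unfolding wK[OF that] by (simp add: cnj_sum)
    then have "(\<Sum>k<d. w k a * cnj (w k a))
        = (\<Sum>k<d. (\<Sum>b\<in>\<Lambda>. K a b * poly (P k) b) * (\<Sum>b\<in>\<Lambda>. K a b * cnj (poly (P k) b)))"
      using wK by (intro sum.cong) auto
    also have "\<dots> = of_nat d * (\<Sum>b\<in>\<Lambda>. K a b * K a b)" by (rule sum_complete[OF P])
    finally show ?thesis by (simp only: power2_eq_square)
  qed
  have "mat_trace (mat_adjoint (FD_mat S x) * FD_mat S x) = (\<Sum>k<d. 1 / of_nat d * (\<Sum>a\<in>\<Lambda>. w k a * cnj (w k a)))"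
    unfolding mat_trace_adjoint_mult[OF FDc] by (intro sum.cong refl column) simp
  also have "\<dots> = 1 / of_nat d * (\<Sum>a\<in>\<Lambda>. \<Sum>k<d. w k a * cnj (w k a))"
    unfolding sum_distrib_left[symmetric] by (subst sum.swap) (rule refl)
  also have "(\<Sum>a\<in>\<Lambda>. \<Sum>k<d. w k a * cnj (w k a)) = (\<Sum>a\<in>\<Lambda>. of_nat d * (\<Sum>b\<in>\<Lambda>. (K a b)\<^sup>2))"
    by (intro sum.cong refl row)
  also have "\<dots> = of_nat d * (\<Sum>b\<in>\<Lambda>. \<Sum>a\<in>\<Lambda>. (K a b)\<^sup>2)"
    unfolding sum_distrib_left[symmetric] by (subst sum.swap) (rule refl)
  also have "(\<Sum>b\<in>\<Lambda>. \<Sum>a\<in>\<Lambda>. (K a b)\<^sup>2) = (\<Sum>b\<in>\<Lambda>. - (1 / 3) * (schwarzian S b / (poly (pderiv S) b)\<^sup>2))"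
    unfolding K_def by (intro sum.cong refl sum_lagrange_deriv)
  also have "\<dots> = - (1 / 3) * (\<Sum>b\<in>\<Lambda>. schwarzian S b / (poly (pderiv S) b)\<^sup>2)"
    by (simp only: sum_distrib_left)
  finally show ?thesis using degree_pos by simp
qed

end


section \<open>The limit\<close>

context expanding_real_julia
begin

lemma real_coeffs_iterate: "real_coeffs (poly_iterate T n)"
proof (induction n)
  case 0
  show ?case by (auto simp: real_coeffs_def coeff_pCons split: nat.splits)
next
  case (Suc n)
  then show ?case unfolding poly_iterate_Suc by (intro real_coeffs_pcompose real_coeffs)
qed

lemma trace_FD_iterate:
  assumes x: "x \<in> I"
  shows "1 / of_nat (degree T ^ n) *
      mat_trace (mat_adjoint (FD_mat (poly_iterate T n) x) * FD_mat (poly_iterate T n) x)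
    = - (1 / 3) * L n (schwarzian (poly_iterate T n)) x"
proof -
  interpret fibre: real_simple_fibre "poly_iterate T n" x
  proof
    fix y assume "poly (poly_iterate T n) y = x"
    then have y: "poly (poly_iterate T n) y \<in> I" using x by simp
    show "y \<in> \<real>" by (rule interval_real[OF iterate_vimage[OF y]])
    show "poly (pderiv (poly_iterate T n)) y \<noteq> 0" using iterate_deriv[OF y] by simp
  qed (rule degree_iterate_pos real_coeffs_iterate)+
  show ?thesis
    using fibre.trace_FD x by (simp add: ruelle2_def degree_poly_iterate)
qed

end

theorem proposition2p6:
  fixes T :: "complex poly" and \<xi> :: real
  assumes "degree T \<ge> 2"
    and "expanding T"
    and "julia T \<subseteq> \<real>"
    and "convex hull (julia T) = sym_interval \<xi>"
    and "poly T -` sym_interval \<xi> \<subseteq> sym_interval \<xi>"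
  shows "ruelle2 T (sym_interval \<xi>) (schwarzian T) \<in> continuous_functions (sym_interval \<xi>)
    \<and> bij_betw (id_minus_ruelle2 T (sym_interval \<xi>))
        (continuous_functions (sym_interval \<xi>)) (continuous_functions (sym_interval \<xi>))
    \<and> (\<forall>x \<in> sym_interval \<xi>.
        (\<lambda>n. 1 / of_nat (degree T ^ n) *
             mat_trace (mat_adjoint (FD_mat (poly_iterate T n) x) * FD_mat (poly_iterate T n) x))
        \<longlonglongrightarrow>
        - (1 / 3) * the_inv_into (continuous_functions (sym_interval \<xi>))
            (id_minus_ruelle2 T (sym_interval \<xi>))
            (ruelle2 T (sym_interval \<xi>) (schwarzian T)) x)"
proof -
  interpret expanding_real_julia T \<xi>
    by standard (rule assms)+
  show ?thesis
  proof (intro conjI ballI)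
    fix x assume x: "x \<in> sym_interval \<xi>"
    show "(\<lambda>n. 1 / of_nat (degree T ^ n) *
             mat_trace (mat_adjoint (FD_mat (poly_iterate T n) x) * FD_mat (poly_iterate T n) x))
        \<longlonglongrightarrow>
        - (1 / 3) * the_inv_into (continuous_functions (sym_interval \<xi>))
            (id_minus_ruelle2 T (sym_interval \<xi>))
            (ruelle2 T (sym_interval \<xi>) (schwarzian T)) x"
      unfolding trace_FD_iterate[OF x]
      by (rule tendsto_mult[OF tendsto_const ruelle2_iterate_schwarzian_limit[OF x]])
  qed (rule ruelle2_schwarzian_continuous id_minus_ruelle2_bij)+
qed

end
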